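(* Suppose that the Bayesian game described in the context satisfies Assumptions A and B stated there. Let $M=[M_{ij}]_{i,j=1}^n$ be the nonnegative matrix with $M_{ii}:=0$ and $M_{ij}:=\tau_{ij}/\sigma_i$ for $i\neq j$. Assume that there exists $w=(w_1,\dots,w_n)$ with $w_i>0$ for all $i$ such that $\|D^{-1}MD\|_\infty<1$, where $D:=\mathrm{diag}(w)$ and $\|\cdot\|_\infty$ denotes the matrix infinity norm (maximum absolute row sum). Then the following assertions hold. (i) For every $p\in[1,\infty]$, the optimal response operator $\Psi$ is a contraction on $\mathcal F$ with respect to $\|\cdot\|_{\infty,w,\mathcal L^p(\eta)}$, and there exists a Bayesian Nash equilibrium (BNE), which is unique $\eta_i$-a.e. for each $i\in N$ (i.e. any two BNEs $f,g$ satisfy $f_i=g_i$ $\eta_i$-almost everywhere for all $i\in N$). (ii) The operator $\Psi$ is also a contraction on $\mathcal F$ with respect to $\|\cdot\|_{\infty,w}$, and the equilibrium is unique pointwise on $\Theta$. (iii) If Assumption A(c) is strengthened by requiring that, for every $i \in N$, the conditional distribution $\eta_i(\cdot\mid\theta_i)$ is setwise continuous in $\theta_i$ (i.e. for every Borel set $S\subset\Theta_{-i}$ the map $\theta_i\mapsto\eta_i(S\mid\theta_i)$ is continuous on $\Theta_i$), then the unique equilibrium is continuous, and hence the game admits a unique continuous BNE.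
   Context: Bayesian game. $N=\{1,\dots,n\}$ is the set of players. For $i\in N$, the type set $\Theta_i\subset\mathbb R^{d_i}$ and the action set $\mathcal A_i\subset\mathbb R^{z_i}$ are non-empty, compact and convex. $\Theta=\prod_i\Theta_i$, $\mathcal A=\prod_i\mathcal A_i$, and the subscript $-i$ denotes the product/vector over all players except $i$ (e.g. $\Theta_{-i}=\prod_{j\ne i}\Theta_j$). Player $i$'s utility is $u_i(a_i,a_{-i},\theta)$, $a=(a_i,a_{-i})\in\mathcal A$, $\theta=(\theta_i,\theta_{-i})\in\Theta$. The type profile $\theta$ has a prior distribution $\eta$, a Borel probability measure on $\Theta$ with full support; $\eta_i$ denotes its marginal on $\Theta_i$, and $\eta_i(\cdot\mid\theta_i)$ the conditional distribution of $\theta_{-i}$ given $\theta_i$, a probability measure on $\Theta_{-i}$ specified for every $\theta_i\in\Theta_i$. Norms of vectors are Euclidean. Strategies. $\mathcal F_i$ is the set of measurable functions $f_i:\Theta_i\to\mathcal A_i$; $\mathcal F=\prod_i\mathcal F_i$, $\mathcal F_{-i}=\prod_{j\neq i}\mathcal F_j$. The expected utility is $\phi_i(a_i,f_{-i},\theta_i)=\int_{\Theta_{-i}}u_i(a_i,f_{-i}(\theta_{-i}),\theta_i,\theta_{-i})\,d\eta_i(\theta_{-i}\mid\theta_i)$. A BNE is an $f^*\in\mathcal F$ with $f_i^*(\theta_i)\in\arg\max_{a_i\in\mathcal A_i}\phi_i(a_i,f^*_{-i},\theta_i)$ for all $\theta_i\in\Theta_i$ and all $i\in N$; it is a continuous BNE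 if each $f_i^*$ is continuous on $\Theta_i$. Assumption A. For each $i\in N$: (a) $u_i(a,\theta)$ is continuous in $(a,\theta)$, and $\nabla_{a_i}u_i(a,\theta)$ is continuous in $a$ and measurable in $\theta$; (b) for each $\hat a_i\in\mathcal A_i$, $f_{-i}\in\mathcal F_{-i}$ and $\theta_i\in\Theta_i$ there exist a neighborhood $\mathcal U_i(\hat a_i;f_{-i},\theta_i)$ of $\hat a_i$ relative to $\mathcal A_i$ and a nonnegative function $h_{\hat a_i,f_{-i}}:\Theta_i\times\Theta_{-i}\to\mathbb R_+$ with $h_{\hat a_i,f_{-i}}(\theta_i,\cdot)\in\mathcal L^1(\eta_i(\cdot\mid\theta_i))$ such that $\sup_{a_i\in\mathcal U_i(\hat a_i;f_{-i},\theta_i)}\|\nabla_{a_i}u_i(a_i,f_{-i}(\theta_{-i}),\theta_i,\theta_{-i})\|\le h_{\hat a_i,f_{-i}}(\theta_i,\theta_{-i})$ for all $\theta_{-i}\in\Theta_{-i}$ (the function $h_{\hat a_i,f_{-i}}$ depends only on $\hat a_i,f_{-i}$, the neighborhood may depend on $\theta_i$ too); (c) for every Borel set $S\subset\Theta_{-i}$, $\eta_i(S\mid\cdot)$ is measurable on $\Theta_i$. Assumption B. For each $i\in N$: (a) there is a constant $\sigma_i>0$ such that $(\nabla_{a_i}u_i(a_i',a_{-i},\theta)-\nabla_{a_i}u_i(a_i'',a_{-i},\theta))^\top(a_i'-a_i'')\le-\sigma_i\|a_i'-a_i''\|^2$ for all $a_i',a_i''\in\mathcal A_i$, $a_{-i}\in\mathcal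 A_{-i}$, $\theta\in\Theta$; (b) there are constants $\tau_{ij}\ge 0$, $j\ne i$, such that $\|\nabla_{a_i}u_i(a_i,a_{-i}',\theta)-\nabla_{a_i}u_i(a_i,a_{-i}'',\theta)\|\le\sum_{j\ne i}\tau_{ij}\|a_j'-a_j''\|$ for all $a_{-i}',a_{-i}''\in\mathcal A_{-i}$, $a_i\in\mathcal A_i$, $\theta\in\Theta$. Operator. Under Assumptions A and B the maximizer $\mathcal A_i^*(f_{-i},\theta_i):=\arg\max_{a_i\in\mathcal A_i}\phi_i(a_i,f_{-i},\theta_i)$ is unique and measurable in $\theta_i$, and $\Psi:\mathcal F\to\mathcal F$ is $\Psi(f):=(\mathcal A_1^*(f_{-1},\cdot),\dots,\mathcal A_n^*(f_{-n},\cdot))$. Norms. $\|f_i\|_{\mathcal L^p(\eta_i)}=(\int_{\Theta_i}\|f_i\|^p\,d\eta_i)^{1/p}$ for $p<\infty$, and the $\eta_i$-essential supremum of $\|f_i(\cdot)\|$ for $p=\infty$; $\|f_i\|_\infty=\sup_{\theta_i\in\Theta_i}\|f_i(\theta_i)\|$; $\|f\|_{\infty,w,\mathcal L^p(\eta)}=\max_{i}\frac1{w_i}\|f_i\|_{\mathcal L^p(\eta_i)}$; $\|f\|_{\infty,w}=\max_i\frac1{w_i}\|f_i\|_\infty$. "Contraction" with respect to such a norm $\|\cdot\|$ means that there is a constant $c<1$ with $\|\Psi(f)-\Psi(g)\|\le c\|f-g\|$ for all $f,g\in\mathcal F$ (for the $\mathcal L^p$ norms, functions equal $\eta_i$-a.e.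 in each component are identified). *)

theory Defs
  imports "HOL-Probability.Probability"
begin

section \<open>Bayesian games\<close>

text \<open>
  Players are the elements of a finite type \<open>'i\<close>, so the number of players is arbitrary but fixed.
  The dimensions of the type and action spaces depend on the player. The copies of
  \<open>\<real>\<^sup>d\<close> (one dimension per player) are linear subspaces \<open>type_space i\<close> and
  \<open>action_space i\<close>, of arbitrary dimension, of ambient Euclidean spaces \<open>'t\<close> and \<open>'a\<close>.

  A profile over a set \<open>J\<close> of players is an extensional function in \<open>PiE J X\<close>. The subscript
  \<open>-i\<close> is the case \<open>J = -{i}\<close>, and \<open>(x, b)\<close> with \<open>b\<close> in \<open>PiE (-{i}) X\<close> is \<open>b(i := x)\<close>.
  Topological notions on profiles refer to the product topology of the function type.

  The conditional distribution is a separate component because it is given for every own type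
  and not only almost everywhere.
\<close>

record ('i, 'a, 't) game =
  type_space :: "'i \<Rightarrow> 't set"
  types :: "'i \<Rightarrow> 't set"
  action_space :: "'i \<Rightarrow> 'a set"
  actions :: "'i \<Rightarrow> 'a set"
  util :: "'i \<Rightarrow> ('i \<Rightarrow> 'a) \<Rightarrow> ('i \<Rightarrow> 't) \<Rightarrow> real"
  prior :: "('i \<Rightarrow> 't) measure"
  cond :: "'i \<Rightarrow> 't \<Rightarrow> ('i \<Rightarrow> 't) measure"

abbreviation borel_on :: "'b::topological_space set \<Rightarrow> 'b measure" where
  "borel_on X \<equiv> restrict_space borel X"

definition profile_algebra :: "('i \<Rightarrow> 'b::topological_space set) \<Rightarrow> 'i set \<Rightarrow> ('i \<Rightarrow> 'b) measure" where
  "profile_algebra X J = PiM J (\<lambda>j. borel_on (X j))"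

text \<open>The product \<open>\<sigma>\<close>-algebra consists of the Borel sets of the product.\<close>

lemma sets_profile_algebra:
  fixes X :: "'i::finite \<Rightarrow> 'b::second_countable_topology set"
  shows "sets (profile_algebra X J) = sets (borel_on (PiE J X))"
proof
  have "id \<in> borel_on (PiE J X) \<rightarrow>\<^sub>M profile_algebra X J"
    unfolding profile_algebra_def
  proof (rule measurable_PiM_single')
    fix j assume j: "j \<in> J"
    have "(\<lambda>x. x j) \<in> borel_on (PiE J X) \<rightarrow>\<^sub>M (borel :: 'b measure)"
      by (intro measurable_restrict_space1 borel_measurable_continuous_onI
          continuous_on_product_coordinates)
    then show "(\<lambda>x. id x j) \<in> borel_on (PiE J X) \<rightarrow>\<^sub>M borel_on (X j)"
      using j by (intro measurable_restrict_space2) (auto simp: space_restrict_space)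
  qed (auto simp: space_restrict_space)
  from measurable_sets[OF this] sets.sets_into_space[where M = "profile_algebra X J"]
  show "sets (profile_algebra X J) \<subseteq> sets (borel_on (PiE J X))"
    by (force simp: space_restrict_space profile_algebra_def space_PiM Int_absorb2)
next
  have sp: "space (profile_algebra X J) = PiE J X"
    by (simp add: profile_algebra_def space_PiM space_restrict_space)
  have "id \<in> profile_algebra X J \<rightarrow>\<^sub>M (borel :: ('i \<Rightarrow> 'b) measure)"
  proof (rule measurable_coordinatewise_then_product)
    fix j
    show "(\<lambda>x. id x j) \<in> profile_algebra X J \<rightarrow>\<^sub>M (borel :: 'b measure)"
    proof (cases "j \<in> J")
      case True
      then have "(\<lambda>x. x j) \<in> profile_algebra X J \<rightarrow>\<^sub>M borel_on (X j)"
        unfolding profile_algebra_def by (rule measurable_component_singleton)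
      then show ?thesis by (simp add: measurable_restrict_space2_iff)
    next
      case False
      then have "\<And>x. x \<in> space (profile_algebra X J) \<Longrightarrow> id x j = undefined"
        using sp by (auto simp: PiE_def extensional_def)
      then show ?thesis by (subst measurable_cong[where g = "\<lambda>_. undefined"]) auto
    qed
  qed
  then have "id \<in> profile_algebra X J \<rightarrow>\<^sub>M borel_on (PiE J X)"
    using sp by (intro measurable_restrict_space2) auto
  from measurable_sets[OF this] sets.sets_into_space[where M = "borel_on (PiE J X)"]
  show "sets (borel_on (PiE J X)) \<subseteq> sets (profile_algebra X J)"
    using sp by (force simp: space_restrict_space Int_absorb2)
qed

definition marginal :: "('i, 'a, 't::topological_space) game \<Rightarrow> 'i \<Rightarrow> 't measure" where
  "marginal G i = distr (prior G) (borel_on (types G i)) (\<lambda>\<theta>. \<theta> i)"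

text \<open>
  The last conjunct says that \<open>cond G i\<close> is a conditional distribution of \<open>\<theta>\<^sub>-\<^sub>i\<close> given
  \<open>\<theta>\<^sub>i\<close>; measurable rectangles determine a measure on the product. Measurability of
  \<open>\<lambda>t. emeasure (cond G i t) S\<close> is part (c) of \<open>assumption_A\<close>.
\<close>

definition bayesian_game :: "('i::finite, 'a::euclidean_space, 't::euclidean_space) game \<Rightarrow> bool" where
  "bayesian_game G \<longleftrightarrow>
     (\<forall>i. subspace (type_space G i) \<and> types G i \<subseteq> type_space G i \<and>
          types G i \<noteq> {} \<and> compact (types G i) \<and> convex (types G i)) \<and>
     (\<forall>i. subspace (action_space G i) \<and> actions G i \<subseteq> action_space G i \<and>
          actions G i \<noteq> {} \<and> compact (actions G i) \<and> convex (actions G i)) \<and>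
     prob_space (prior G) \<and> sets (prior G) = sets (profile_algebra (types G) UNIV) \<and>
     (\<forall>U. openin (top_of_set (PiE UNIV (types G))) U \<and> U \<noteq> {} \<longrightarrow> emeasure (prior G) U > 0) \<and>
     (\<forall>i. \<forall>t \<in> types G i. prob_space (cond G i t) \<and>
          sets (cond G i t) = sets (profile_algebra (types G) (- {i}))) \<and>
     (\<forall>i. \<forall>B \<in> sets (borel_on (types G i)). \<forall>S \<in> sets (profile_algebra (types G) (- {i})).
          emeasure (prior G) {\<theta> \<in> PiE UNIV (types G). \<theta> i \<in> B \<and> restrict \<theta> (- {i}) \<in> S}
          = (\<integral>\<^sup>+ t \<in> B. emeasure (cond G i t) S \<partial>marginal G i))"

text \<open>
  \<open>grad i a \<theta>\<close> is the gradient of player \<open>i\<close>'s utility in the own action. The derivative is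
  taken within the action set, so one-sided at boundary points. It determines the gradient if the
  action set has interior points in \<open>action_space G i\<close>; otherwise \<open>grad\<close> may be any
  field of vectors representing the derivative.
\<close>

definition action_gradient ::
    "('i, 'a::euclidean_space, 't) game \<Rightarrow> ('i \<Rightarrow> ('i \<Rightarrow> 'a) \<Rightarrow> ('i \<Rightarrow> 't) \<Rightarrow> 'a) \<Rightarrow> bool" where
  "action_gradient G grad \<longleftrightarrow>
     (\<forall>i. \<forall>a \<in> PiE UNIV (actions G). \<forall>\<theta> \<in> PiE UNIV (types G).
        grad i a \<theta> \<in> action_space G i \<and>
        ((\<lambda>x. util G i (a(i := x)) \<theta>) has_derivative (\<lambda>h. grad i a \<theta> \<bullet> h))
          (at (a i) within actions G i))"


section \<open>Strategies and equilibria\<close>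

text \<open>Only the values of the \<open>i\<close>-th component on \<open>types G i\<close> are relevant.\<close>

definition strategies_on ::
    "('i, 'a::topological_space, 't::topological_space) game \<Rightarrow> 'i set \<Rightarrow> ('i \<Rightarrow> 't \<Rightarrow> 'a) set" where
  "strategies_on G J = {f. \<forall>j \<in> J. f j \<in> borel_on (types G j) \<rightarrow>\<^sub>M borel_on (actions G j)}"

abbreviation strategies ::
    "('i, 'a::topological_space, 't::topological_space) game \<Rightarrow> ('i \<Rightarrow> 't \<Rightarrow> 'a) set" where
  "strategies G \<equiv> strategies_on G UNIV"

definition others :: "'i \<Rightarrow> ('i \<Rightarrow> 't \<Rightarrow> 'a) \<Rightarrow> ('i \<Rightarrow> 't) \<Rightarrow> 'i \<Rightarrow> 'a" where
  "others i f s = (\<lambda>j \<in> - {i}. f j (s j))"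

definition expected_util ::
    "('i, 'a, 't) game \<Rightarrow> 'i \<Rightarrow> 'a \<Rightarrow> ('i \<Rightarrow> 't \<Rightarrow> 'a) \<Rightarrow> 't \<Rightarrow> real" where
  "expected_util G i x f t =
     (\<integral>s. util G i ((others i f s)(i := x)) (s(i := t)) \<partial>cond G i t)"

definition is_best_response ::
    "('i, 'a, 't) game \<Rightarrow> 'i \<Rightarrow> ('i \<Rightarrow> 't \<Rightarrow> 'a) \<Rightarrow> 't \<Rightarrow> 'a \<Rightarrow> bool" where
  "is_best_response G i f t x \<longleftrightarrow>
     is_arg_max (\<lambda>y. expected_util G i y f t) (\<lambda>y. y \<in> actions G i) x"

definition response :: "('i, 'a, 't) game \<Rightarrow> ('i \<Rightarrow> 't \<Rightarrow> 'a) \<Rightarrow> 'i \<Rightarrow> 't \<Rightarrow> 'a" where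
  "response G f i t = (THE x. is_best_response G i f t x)"

definition BNE ::
    "('i, 'a::topological_space, 't::topological_space) game \<Rightarrow> ('i \<Rightarrow> 't \<Rightarrow> 'a) \<Rightarrow> bool" where
  "BNE G f \<longleftrightarrow> f \<in> strategies G \<and> (\<forall>i. \<forall>t \<in> types G i. is_best_response G i f t (f i t))"

definition continuous_BNE ::
    "('i, 'a::topological_space, 't::topological_space) game \<Rightarrow> ('i \<Rightarrow> 't \<Rightarrow> 'a) \<Rightarrow> bool" where
  "continuous_BNE G f \<longleftrightarrow> BNE G f \<and> (\<forall>i. continuous_on (types G i) (f i))"


section \<open>Assumptions\<close>

text \<open>
  In (b), \<open>h\<close> is chosen before the own type \<open>t\<close> and the neighborhood \<open>U\<close> after it.
\<close>

definition assumption_A ::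
    "('i::finite, 'a::euclidean_space, 't::euclidean_space) game \<Rightarrow>
     ('i \<Rightarrow> ('i \<Rightarrow> 'a) \<Rightarrow> ('i \<Rightarrow> 't) \<Rightarrow> 'a) \<Rightarrow> bool" where
  "assumption_A G grad \<longleftrightarrow> (\<forall>i.
     (continuous_on (PiE UNIV (actions G) \<times> PiE UNIV (types G)) (\<lambda>(a, \<theta>). util G i a \<theta>) \<and>
      (\<forall>\<theta> \<in> PiE UNIV (types G). continuous_on (PiE UNIV (actions G)) (\<lambda>a. grad i a \<theta>)) \<and>
      (\<forall>a \<in> PiE UNIV (actions G).
         (\<lambda>\<theta>. grad i a \<theta>) \<in> borel_measurable (profile_algebra (types G) UNIV))) \<and>
     (\<forall>x \<in> actions G i. \<forall>f \<in> strategies_on G (- {i}).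
        \<exists>h. (\<forall>t \<in> types G i. \<forall>s \<in> PiE (- {i}) (types G). h t s \<ge> 0) \<and>
            (\<forall>t \<in> types G i.
               integrable (cond G i t) (h t) \<and>
               (\<exists>U. openin (top_of_set (actions G i)) U \<and> x \<in> U \<and>
                  (\<forall>s \<in> PiE (- {i}) (types G). \<forall>y \<in> U.
                     norm (grad i ((others i f s)(i := y)) (s(i := t))) \<le> h t s)))) \<and>
     (\<forall>S \<in> sets (profile_algebra (types G) (- {i})).
        (\<lambda>t. measure (cond G i t) S) \<in> borel_measurable (borel_on (types G i))))"

definition assumption_B ::
    "('i::finite, 'a::euclidean_space, 't::euclidean_space) game \<Rightarrow>
     ('i \<Rightarrow> ('i \<Rightarrow> 'a) \<Rightarrow> ('i \<Rightarrow> 't) \<Rightarrow> 'a) \<Rightarrow> ('i \<Rightarrow> real) \<Rightarrow> ('i \<Rightarrow> 'i \<Rightarrow> real) \<Rightarrow> bool" where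
  "assumption_B G grad \<sigma> \<tau> \<longleftrightarrow> (\<forall>i.
     (\<sigma> i > 0 \<and>
      (\<forall>x \<in> actions G i. \<forall>y \<in> actions G i. \<forall>b \<in> PiE (- {i}) (actions G).
         \<forall>\<theta> \<in> PiE UNIV (types G).
           (grad i (b(i := x)) \<theta> - grad i (b(i := y)) \<theta>) \<bullet> (x - y) \<le> - \<sigma> i * (norm (x - y))\<^sup>2)) \<and>
     ((\<forall>j \<in> - {i}. \<tau> i j \<ge> 0) \<and>
      (\<forall>b \<in> PiE (- {i}) (actions G). \<forall>b' \<in> PiE (- {i}) (actions G). \<forall>x \<in> actions G i.
         \<forall>\<theta> \<in> PiE UNIV (types G).
           norm (grad i (b(i := x)) \<theta> - grad i (b'(i := x)) \<theta>)
             \<le> (\<Sum>j \<in> - {i}. \<tau> i j * norm (b j - b' j)))))"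

definition setwise_continuous ::
    "('i, 'a, 't::topological_space) game \<Rightarrow> bool" where
  "setwise_continuous G \<longleftrightarrow>
     (\<forall>i. \<forall>S \<in> sets (profile_algebra (types G) (- {i})).
        continuous_on (types G i) (\<lambda>t. measure (cond G i t) S))"


section \<open>Norms\<close>

definition diag_matrix :: "('i \<Rightarrow> real) \<Rightarrow> real^'i^'i" where
  "diag_matrix w = (\<chi> i j. if i = j then w i else 0)"

definition matrix_inf_norm :: "real^'i::finite^'i \<Rightarrow> real" where
  "matrix_inf_norm A = (MAX i. \<Sum>j\<in>UNIV. \<bar>A $ i $ j\<bar>)"

definition interaction_matrix :: "('i \<Rightarrow> real) \<Rightarrow> ('i \<Rightarrow> 'i \<Rightarrow> real) \<Rightarrow> real^'i^'i" where
  "interaction_matrix \<sigma> \<tau> = (\<chi> i j. if i = j then 0 else \<tau> i j / \<sigma> i)"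

text \<open>
  All norms below are applied to differences of strategies, which are bounded and measurable, so
  the integral, the essential supremum and the supremum are genuine and finite.
\<close>

definition Lp_norm :: "ennreal \<Rightarrow> 't measure \<Rightarrow> ('t \<Rightarrow> 'a::real_normed_vector) \<Rightarrow> real" where
  "Lp_norm p M g =
     (if p = \<infinity> then real_of_ereal (esssup M (\<lambda>t. ereal (norm (g t))))
      else (\<integral>t. norm (g t) powr enn2real p \<partial>M) powr (1 / enn2real p))"

definition weighted_Lp_norm ::
    "('i::finite, 'a::real_normed_vector, 't::topological_space) game \<Rightarrow> ('i \<Rightarrow> real) \<Rightarrow> ennreal \<Rightarrow>
     ('i \<Rightarrow> 't \<Rightarrow> 'a) \<Rightarrow> real" where
  "weighted_Lp_norm G w p f = (MAX i. 1 / w i * Lp_norm p (marginal G i) (f i))"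

definition weighted_sup_norm ::
    "('i::finite, 'a::real_normed_vector, 't) game \<Rightarrow> ('i \<Rightarrow> real) \<Rightarrow> ('i \<Rightarrow> 't \<Rightarrow> 'a) \<Rightarrow> real" where
  "weighted_sup_norm G w f = (MAX i. 1 / w i * (SUP t \<in> types G i. norm (f i t)))"

text \<open>
  For the \<open>\<L>\<^sup>p\<close> norms the inequality also shows that the operator respects equality almost
  everywhere, so it is stated for representatives.
\<close>

definition contraction_wrt ::
    "(('i \<Rightarrow> 't \<Rightarrow> 'a::real_normed_vector) \<Rightarrow> real) \<Rightarrow> ('i \<Rightarrow> 't \<Rightarrow> 'a) set \<Rightarrow>
     (('i \<Rightarrow> 't \<Rightarrow> 'a) \<Rightarrow> ('i \<Rightarrow> 't \<Rightarrow> 'a)) \<Rightarrow> bool" where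
  "contraction_wrt nrm F \<Psi> \<longleftrightarrow>
     (\<forall>f \<in> F. \<Psi> f \<in> F) \<and>
     (\<exists>c<1. \<forall>f \<in> F. \<forall>g \<in> F.
        nrm (\<lambda>i t. \<Psi> f i t - \<Psi> g i t) \<le> c * nrm (\<lambda>i t. f i t - g i t))"

end

theory Submission
  imports Defs
begin

text \<open>
  Write \<open>\<phi>(x, t)\<close> for the expected utility of player \<open>i\<close> with action \<open>x\<close> and own type \<open>t\<close>
  against strategies \<open>f\<close>, and \<open>\<Psi>\<close> for the operator \<open>response G\<close>. The argument compares values of
  expected utilities and takes derivatives only of the utility at fixed profiles.

  By the monotonicity of the gradient, the utility is strongly concave in the own action with
  modulus \<open>\<sigma> i\<close>, and strong concavity survives integration. A strongly concave function drops by at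
  least \<open>\<sigma> i / 2 * |x - y|\<^sup>2\<close> when one moves from its maximizer \<open>x\<close> to another point \<open>y\<close>. Adding
  this for two functions \<open>u\<close>, \<open>v\<close> with maximizers \<open>x\<close>, \<open>y\<close> gives the stability estimate
  \<open>\<sigma> i * |x - y|\<^sup>2 \<le> (u - v) x - (u - v) y\<close> (\<open>growth_maximizer_stability\<close>), on which everything
  rests.

  Let \<open>u\<close> and \<open>v\<close> be the expected utilities against \<open>f\<close> and \<open>g\<close>. Pointwise in the opponents' types
  the difference of utilities has a gradient bounded by \<open>\<Sum>j. \<tau> i j * |f j - g j|\<close>, so the mean value
  theorem and one cancelled factor \<open>|x - y|\<close> yield, for every own type \<open>t\<close>,
  \<open>|\<Psi> f i t - \<Psi> g i t| \<le> \<Sum>j. \<tau> i j / \<sigma> i * E[|f j - g j| given t]\<close>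
  (\<open>response_lipschitz\<close>). The weighted row sums of the coefficients are at most \<open>c < 1\<close>, and the
  contraction property follows in each norm: in the supremum norm directly; for \<open>p = \<infinity>\<close> because
  an \<open>\<eta>\<^sub>j\<close>-null set is null under the conditional law given almost every \<open>t\<close>; for
  finite \<open>p\<close> from Jensen's inequality and the fact that averaging the conditional laws of
  \<open>\<theta>\<^sub>j\<close> over \<open>\<theta>\<^sub>i\<close> gives the marginal of \<open>\<theta>\<^sub>j\<close> (\<open>marginal_eq_bind\<close>).

  Responses are measurable in the type because, by quadratic growth, near-maximizers chosen from a
  countable dense set converge to the maximizer. Iterating \<open>\<Psi>\<close> therefore stays in the strategy
  space, and the supremum-norm contraction produces an equilibrium for every type, unique at every
  type. If the conditional laws are setwise continuous, \<open>\<phi>\<close> is jointly continuous in \<open>(x, t)\<close>, and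
  the same stability estimate, now comparing two types, makes each response, hence each equilibrium,
  continuous.
\<close>

section \<open>Strongly concave functions and their maximizers\<close>

definition strongly_concave_on :: "'a::real_inner set \<Rightarrow> real \<Rightarrow> ('a \<Rightarrow> real) \<Rightarrow> bool" where
  "strongly_concave_on A s u \<longleftrightarrow>
     (\<forall>x\<in>A. \<forall>y\<in>A. \<forall>r\<in>{0..1}.
        (1 - r) * u x + r * u y + s / 2 * (r * (1 - r) * (norm (x - y))\<^sup>2)
          \<le> u ((1 - r) *\<^sub>R x + r *\<^sub>R y))"

text \<open>
  Along the segment from \<open>x\<close> to \<open>y\<close>, the difference between \<open>u\<close> and the claimed quadratic bound has
  a nonpositive derivative, since the gradient at distance \<open>r\<close> has moved against the direction by at
  least \<open>s * r\<close>.
\<close>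

lemma strongly_monotone_gradient_upper_bound:
  fixes u :: "'a::real_inner \<Rightarrow> real"
  assumes A: "convex A"
    and der: "\<And>x. x \<in> A \<Longrightarrow> (u has_derivative (\<lambda>h. g x \<bullet> h)) (at x within A)"
    and mono: "\<And>x y. x \<in> A \<Longrightarrow> y \<in> A \<Longrightarrow> (g x - g y) \<bullet> (x - y) \<le> - s * (norm (x - y))\<^sup>2"
    and x: "x \<in> A" and y: "y \<in> A"
  shows "u y \<le> u x + g x \<bullet> (y - x) - s / 2 * (norm (y - x))\<^sup>2"
proof -
  define c where "c r = x + r *\<^sub>R (y - x)" for r :: real
  define v where "v r = u (c r) - r * (g x \<bullet> (y - x)) + s / 2 * r\<^sup>2 * (norm (y - x))\<^sup>2" for r
  have c_in: "c r \<in> A" if "0 \<le> r" "r \<le> 1" for r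
  proof -
    have "c r = (1 - r) *\<^sub>R x + r *\<^sub>R y" by (simp add: c_def algebra_simps)
    then show ?thesis using A x y that by (auto intro: convexD_alt)
  qed
  have dc: "(c has_derivative (\<lambda>h. h *\<^sub>R (y - x))) (at r within {0..1})" for r
    unfolding c_def by (auto intro!: derivative_eq_intros)
  have dv: "(v has_derivative (\<lambda>h. g (c r) \<bullet> (h *\<^sub>R (y - x)) - h * (g x \<bullet> (y - x))
      + s * r * h * (norm (y - x))\<^sup>2)) (at r within {0..1})" if r: "0 \<le> r" "r \<le> 1" for r
  proof -
    have "((\<lambda>r. u (c r)) has_derivative (\<lambda>h. g (c r) \<bullet> (h *\<^sub>R (y - x)))) (at r within {0..1})"
      using c_in by (intro has_derivative_in_compose2[OF der _ _ dc]) (use r in auto)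
    then show ?thesis
      unfolding v_def by (auto intro!: derivative_eq_intros simp: field_simps)
  qed
  obtain r where r: "r \<in> {0<..<1}" and eq: "v 1 - v 0 = g (c r) \<bullet> (1 *\<^sub>R (y - x)) - 1 * (g x \<bullet> (y - x))
      + s * r * 1 * (norm (y - x))\<^sup>2"
    using mvt_simple[of 0 1 v, OF _ dv] by auto
  have "(g (c r) - g x) \<bullet> (c r - x) \<le> - s * (norm (c r - x))\<^sup>2"
    using r c_in x by (intro mono) auto
  moreover have cx: "c r - x = r *\<^sub>R (y - x)" by (simp add: c_def)
  ultimately have "r * ((g (c r) - g x) \<bullet> (y - x)) \<le> r * (- s * r * (norm (y - x))\<^sup>2)"
    using r unfolding cx by (simp add: power_mult_distrib power2_eq_square mult_ac)
  then have "(g (c r) - g x) \<bullet> (y - x) \<le> - s * r * (norm (y - x))\<^sup>2"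
    by (rule mult_left_le_imp_le) (use r in simp)
  then have "v 1 \<le> v 0" using eq by (simp add: algebra_simps)
  then show ?thesis by (simp add: v_def c_def)
qed

text \<open>
  Apply the quadratic upper bound at \<open>z = (1 - r) x + r y\<close> to both endpoints and average: the linear
  terms cancel.
\<close>

lemma strongly_concave_on_gradientI:
  fixes u :: "'a::real_inner \<Rightarrow> real"
  assumes A: "convex A"
    and der: "\<And>x. x \<in> A \<Longrightarrow> (u has_derivative (\<lambda>h. g x \<bullet> h)) (at x within A)"
    and mono: "\<And>x y. x \<in> A \<Longrightarrow> y \<in> A \<Longrightarrow> (g x - g y) \<bullet> (x - y) \<le> - s * (norm (x - y))\<^sup>2"
  shows "strongly_concave_on A s u"
  unfolding strongly_concave_on_def
proof (intro ballI)
  fix x y and r :: real assume x: "x \<in> A" and y: "y \<in> A" and r: "r \<in> {0..1}"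
  define z where "z = (1 - r) *\<^sub>R x + r *\<^sub>R y"
  have z: "z \<in> A" using A x y r by (auto simp: z_def intro: convexD_alt)
  have xz: "x - z = r *\<^sub>R (x - y)" and yz: "y - z = (1 - r) *\<^sub>R (y - x)"
    by (auto simp: z_def algebra_simps)
  note bound = strongly_monotone_gradient_upper_bound[OF A der mono z]
  have "(1 - r) * u x \<le> (1 - r) * (u z + g z \<bullet> (x - z) - s / 2 * (norm (x - z))\<^sup>2)"
    using r by (intro mult_left_mono bound x) auto
  moreover have "r * u y \<le> r * (u z + g z \<bullet> (y - z) - s / 2 * (norm (y - z))\<^sup>2)"
    using r by (intro mult_left_mono bound y) auto
  moreover have "(1 - r) * (u z + g z \<bullet> (x - z) - s / 2 * (norm (x - z))\<^sup>2)
      + r * (u z + g z \<bullet> (y - z) - s / 2 * (norm (y - z))\<^sup>2)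
      = u z - s / 2 * (r * (1 - r) * (norm (x - y))\<^sup>2)"
  proof -
    have "(norm (y - z))\<^sup>2 = (1 - r)\<^sup>2 * (norm (x - y))\<^sup>2" "(norm (x - z))\<^sup>2 = r\<^sup>2 * (norm (x - y))\<^sup>2"
      by (simp_all add: xz yz power_mult_distrib norm_minus_commute)
    moreover have "g z \<bullet> (x - z) = r * (g z \<bullet> (x - y))" and "g z \<bullet> (y - z) = - (1 - r) * (g z \<bullet> (x - y))"
      by (simp_all add: xz yz inner_diff_right algebra_simps)
    ultimately show ?thesis by (simp only:) (simp add: field_simps power2_eq_square)
  qed
  ultimately show "(1 - r) * u x + r * u y + s / 2 * (r * (1 - r) * (norm (x - y))\<^sup>2) \<le> u z"
    by linarith
qed

lemma strongly_concave_on_integral: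
  assumes "prob_space M"
    and conc: "\<And>z. z \<in> space M \<Longrightarrow> strongly_concave_on A s (\<lambda>x. u x z)"
    and int: "\<And>x. x \<in> A \<Longrightarrow> integrable M (u x)"
    and A: "convex A"
  shows "strongly_concave_on A s (\<lambda>x. \<integral>z. u x z \<partial>M)"
  unfolding strongly_concave_on_def
proof (intro ballI)
  interpret prob_space M by fact
  fix x y and r :: real assume x: "x \<in> A" and y: "y \<in> A" and r: "r \<in> {0..1}"
  have xy: "(1 - r) *\<^sub>R x + r *\<^sub>R y \<in> A" using A x y r by (auto intro: convexD_alt)
  have "(1 - r) * (\<integral>z. u x z \<partial>M) + r * (\<integral>z. u y z \<partial>M) + s / 2 * (r * (1 - r) * (norm (x - y))\<^sup>2)
      = (\<integral>z. (1 - r) * u x z + r * u y z + s / 2 * (r * (1 - r) * (norm (x - y))\<^sup>2) \<partial>M)"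
    using int[OF x] int[OF y] by (simp add: prob_space)
  also have "\<dots> \<le> (\<integral>z. u ((1 - r) *\<^sub>R x + r *\<^sub>R y) z \<partial>M)"
    using int[OF x] int[OF y] int[OF xy] conc x y r
    by (intro integral_mono) (auto simp: strongly_concave_on_def)
  finally show "(1 - r) * (\<integral>z. u x z \<partial>M) + r * (\<integral>z. u y z \<partial>M)
      + s / 2 * (r * (1 - r) * (norm (x - y))\<^sup>2) \<le> (\<integral>z. u ((1 - r) *\<^sub>R x + r *\<^sub>R y) z \<partial>M)" .
qed

text \<open>
  A maximizer with quadratic growth. This consequence of strong concavity is all that stability,
  measurability and continuity of maximizers require.
\<close>

definition growth_maximizer :: "'a::real_normed_vector set \<Rightarrow> real \<Rightarrow> ('a \<Rightarrow> real) \<Rightarrow> 'a \<Rightarrow> bool" where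
  "growth_maximizer A s u x \<longleftrightarrow> x \<in> A \<and> (\<forall>y\<in>A. u y \<le> u x - s / 2 * (norm (x - y))\<^sup>2)"

text \<open>
  Compare the maximum with the value at \<open>(1 - r) x + r y\<close>, divide by \<open>r\<close> and let \<open>r\<close> tend to \<open>0\<close>.
\<close>

lemma strongly_concave_on_maximizer_growth:
  assumes conc: "strongly_concave_on A s u" and A: "convex A" and x: "x \<in> A"
    and max: "\<And>y. y \<in> A \<Longrightarrow> u y \<le> u x"
  shows "growth_maximizer A s u x"
  unfolding growth_maximizer_def
proof (intro conjI ballI x)
  fix y assume y: "y \<in> A"
  have le: "u y + s / 2 * ((1 - r) * (norm (x - y))\<^sup>2) \<le> u x" if r: "0 < r" "r < 1" for r
  proof -
    have "(1 - r) * u x + r * u y + s / 2 * (r * (1 - r) * (norm (x - y))\<^sup>2)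
        \<le> u ((1 - r) *\<^sub>R x + r *\<^sub>R y)"
      using conc x y r by (auto simp: strongly_concave_on_def)
    also have "\<dots> \<le> u x" using A x y r by (intro max convexD_alt) auto
    finally have "r * (u y + s / 2 * ((1 - r) * (norm (x - y))\<^sup>2)) \<le> r * u x"
      by (simp add: algebra_simps)
    then show ?thesis using r by simp
  qed
  have "((\<lambda>r. u y + s / 2 * ((1 - r) * (norm (x - y))\<^sup>2)) \<longlongrightarrow>
      u y + s / 2 * ((1 - 0) * (norm (x - y))\<^sup>2)) (at_right 0)"
    by (intro tendsto_intros)
  moreover have "\<forall>\<^sub>F r in at_right 0. u y + s / 2 * ((1 - r) * (norm (x - y))\<^sup>2) \<le> u x"
    using eventually_at_right_real[OF zero_less_one] by (rule eventually_mono) (use le in auto)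
  ultimately have "u y + s / 2 * ((1 - 0) * (norm (x - y))\<^sup>2) \<le> u x"
    by (intro tendsto_upperbound) auto
  then show "u y \<le> u x - s / 2 * (norm (x - y))\<^sup>2" by simp
qed

text \<open>
  The sum of the two growth inequalities \<open>u y \<le> u x - \<dots>\<close> and \<open>v x \<le> v y - \<dots>\<close>.
\<close>

lemma growth_maximizer_stability:
  assumes "growth_maximizer A s u x" and "growth_maximizer A s v y"
  shows "s * (norm (x - y))\<^sup>2 \<le> (u x - v x) - (u y - v y)"
proof -
  have "u y \<le> u x - s / 2 * (norm (x - y))\<^sup>2" "v x \<le> v y - s / 2 * (norm (y - x))\<^sup>2"
    using assms by (auto simp: growth_maximizer_def)
  then show ?thesis by (simp add: norm_minus_commute)
qed

text \<open>
  Enumerate a countable dense subset of \<open>A\<close> and let \<open>Y k t\<close> be its first element whose value lies at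
  most \<open>1 / (k + 1)\<close> below every value on the subset. \<open>Y k\<close> is measurable since only countably many
  comparisons of measurable functions are involved, and by quadratic growth \<open>Y k t\<close> converges to
  \<open>X t\<close>.
\<close>

lemma measurable_growth_maximizer:
  fixes u :: "'a::euclidean_space \<Rightarrow> 'm \<Rightarrow> real"
  assumes s: "s > 0"
    and meas: "\<And>x. x \<in> A \<Longrightarrow> u x \<in> borel_measurable M"
    and cont: "\<And>t. t \<in> space M \<Longrightarrow> continuous_on A (\<lambda>x. u x t)"
    and max: "\<And>t. t \<in> space M \<Longrightarrow> growth_maximizer A s (\<lambda>x. u x t) (X t)"
  shows "X \<in> borel_measurable M"
proof (cases "space M = {}")
  case True
  then show ?thesis by (simp add: measurable_def)
next
  case False
  then have "A \<noteq> {}" using max by (auto simp: growth_maximizer_def)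
  obtain D where D: "countable D" "D \<subseteq> A" "A \<subseteq> closure D"
    using separable[of A] by blast
  with \<open>A \<noteq> {}\<close> have "D \<noteq> {}" by auto
  define d where "d = from_nat_into D"
  have range_d: "range d = D" using D \<open>D \<noteq> {}\<close> by (simp add: d_def)
  then have d_in: "d n \<in> A" for n using D by auto
  define P where "P k n t \<longleftrightarrow> (\<forall>m. u (d m) t \<le> u (d n) t + 1 / real (Suc k))" for k n t
  define Y where "Y k t = d (LEAST n. P k n t)" for k t
  have [measurable]: "(\<lambda>t. u (d n) t) \<in> borel_measurable M" for n using meas d_in by simp
  have "Y k \<in> borel_measurable M" for k
    unfolding Y_def P_def by measurable
  moreover have "(\<lambda>k. Y k t) \<longlonglongrightarrow> X t" if t: "t \<in> space M" for t
  proof -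
    have X: "X t \<in> A" and grow: "\<And>y. y \<in> A \<Longrightarrow> u y t \<le> u (X t) t - s / 2 * (norm (X t - y))\<^sup>2"
      using max[OF t] by (auto simp: growth_maximizer_def)
    \<comment> \<open>By density and continuity, the maximum is the supremum over the countable set.\<close>
    have near: "\<exists>n. u (X t) t < u (d n) t + e" if "e > 0" for e
    proof -
      obtain \<delta> where "\<delta> > 0" and \<delta>: "\<And>y. y \<in> A \<Longrightarrow> dist y (X t) < \<delta> \<Longrightarrow> dist (u y t) (u (X t) t) < e"
        using cont[OF t] X \<open>e > 0\<close> unfolding continuous_on_iff by metis
      obtain y where "y \<in> D" "dist y (X t) < \<delta>"
        using X D \<open>\<delta> > 0\<close> closure_approachable by blast
      moreover from this obtain n where "y = d n" using range_d by auto
      ultimately have "dist (u (d n) t) (u (X t) t) < e" using d_in by (intro \<delta>) auto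
      then show ?thesis by (intro exI[of _ n]) (auto simp: dist_real_def)
    qed
    have Y: "Y k t \<in> A" "u (X t) t \<le> u (Y k t) t + 1 / real (Suc k)" for k
    proof -
      show "Y k t \<in> A" by (simp add: Y_def d_in)
      obtain n where "u (X t) t < u (d n) t + 1 / real (Suc k)" using near by force
      moreover have "u (d m) t \<le> u (X t) t" for m
        using grow[OF d_in, of m] s by (smt (verit) divide_nonneg_nonneg mult_nonneg_nonneg zero_le_power2)
      ultimately have "P k n t" unfolding P_def by (meson less_eq_real_def order_le_less_trans)
      then have "P k (LEAST n. P k n t) t" by (rule LeastI)
      then have le: "u (d m) t \<le> u (Y k t) t + 1 / real (Suc k)" for m by (simp add: P_def Y_def)
      show "u (X t) t \<le> u (Y k t) t + 1 / real (Suc k)"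
      proof (rule field_le_epsilon)
        fix e :: real assume "e > 0"
        then obtain n where "u (X t) t < u (d n) t + e" using near by blast
        then show "u (X t) t \<le> u (Y k t) t + 1 / real (Suc k) + e" using le[of n] by simp
      qed
    qed
    have "(norm (Y k t - X t))\<^sup>2 \<le> 2 / s * (1 / real (Suc k))" for k
    proof -
      have "s / 2 * (norm (Y k t - X t))\<^sup>2 \<le> 1 / real (Suc k)"
        using grow[OF Y(1), of k] Y(2)[of k] by (simp add: norm_minus_commute)
      then have "2 / s * (s / 2 * (norm (Y k t - X t))\<^sup>2) \<le> 2 / s * (1 / real (Suc k))"
        using s by (intro mult_left_mono) auto
      then show ?thesis using s by simp
    qed
    moreover have "(\<lambda>k. 2 / s * (1 / real (Suc k))) \<longlonglongrightarrow> 0"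
      using tendsto_mult_left[OF lim_1_over_n[THEN LIMSEQ_Suc], of "2 / s"] by (simp add: field_simps)
    ultimately have "(\<lambda>k. (norm (Y k t - X t))\<^sup>2) \<longlonglongrightarrow> 0"
      by (intro Lim_null_comparison[of "\<lambda>k. (norm (Y k t - X t))\<^sup>2"]) auto
    then have "(\<lambda>k. sqrt ((norm (Y k t - X t))\<^sup>2)) \<longlonglongrightarrow> sqrt 0" by (rule tendsto_real_sqrt)
    then show ?thesis by (simp add: tendsto_norm_zero_iff LIM_zero_iff)
  qed
  ultimately show ?thesis by (rule borel_measurable_LIMSEQ_metric)
qed

text \<open>
  Compactness turns joint continuity into uniform closeness of \<open>u \<cdot> t\<close> and \<open>u \<cdot> t'\<close>, and stability
  bounds the distance of their maximizers by the uniform distance of the functions.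
\<close>

lemma continuous_on_growth_maximizer:
  fixes u :: "'a::euclidean_space \<Rightarrow> 'b::metric_space \<Rightarrow> real"
  assumes s: "s > 0" and A: "compact A" and T: "compact T"
    and cont: "continuous_on (A \<times> T) (\<lambda>(x, t). u x t)"
    and max: "\<And>t. t \<in> T \<Longrightarrow> growth_maximizer A s (\<lambda>x. u x t) (X t)"
  shows "continuous_on T X"
  unfolding continuous_on_iff
proof (intro ballI allI impI)
  fix t and e :: real assume t: "t \<in> T" and "e > 0"
  have unif: "uniformly_continuous_on (A \<times> T) (\<lambda>(x, t). u x t)"
    using compact_uniformly_continuous[OF cont compact_Times[OF A T]] .
  have "s * e\<^sup>2 / 2 > 0" using s \<open>e > 0\<close> by simp
  then obtain \<delta> where "\<delta> > 0" and \<delta>: "\<And>p q. p \<in> A \<times> T \<Longrightarrow> q \<in> A \<times> T \<Longrightarrow> dist q p < \<delta> \<Longrightarrow>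
      dist (case q of (x, t) \<Rightarrow> u x t) (case p of (x, t) \<Rightarrow> u x t) < s * e\<^sup>2 / 2"
    using unif unfolding uniformly_continuous_on_def by metis
  have "dist (X t') (X t) < e" if t': "t' \<in> T" "dist t' t < \<delta>" for t'
  proof -
    have "X t \<in> A" "X t' \<in> A" using max t t' by (auto simp: growth_maximizer_def)
    then have "dist (u (X t) t') (u (X t) t) < s * e\<^sup>2 / 2" "dist (u (X t') t') (u (X t') t) < s * e\<^sup>2 / 2"
      using \<delta>[of "(X t, t)" "(X t, t')"] \<delta>[of "(X t', t)" "(X t', t')"] t t' by (auto simp: dist_Pair_Pair)
    then have "s * (norm (X t - X t'))\<^sup>2 < s * e\<^sup>2"
      using growth_maximizer_stability[OF max[OF t] max[OF t'(1)]] unfolding dist_real_def by linarith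
    then have "(norm (X t - X t'))\<^sup>2 < e\<^sup>2" using s by simp
    then have "norm (X t - X t') < e" using \<open>e > 0\<close> by (simp add: power_less_imp_less_base)
    then show ?thesis by (simp add: dist_norm norm_minus_commute)
  qed
  then show "\<exists>\<delta>>0. \<forall>t'\<in>T. dist t' t < \<delta> \<longrightarrow> dist (X t') (X t) < e" using \<open>\<delta> > 0\<close> by blast
qed


section \<open>Integrals against a varying measure\<close>

text \<open>
  Pushing \<open>L x\<close> forward to the product along \<open>y \<mapsto> (x, y)\<close> removes the parameter from the integrand,
  and the integral of a fixed function depends measurably on the measure.
\<close>

lemma measurable_integral_kernel:
  fixes f :: "'m \<Rightarrow> 'n \<Rightarrow> real"
  assumes f: "(\<lambda>(x, y). f x y) \<in> borel_measurable (M \<Otimes>\<^sub>M N)"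
    and L: "L \<in> M \<rightarrow>\<^sub>M subprob_algebra N"
  shows "(\<lambda>x. \<integral>y. f x y \<partial>L x) \<in> borel_measurable M"
proof -
  have "(\<lambda>x. distr (L x) (M \<Otimes>\<^sub>M N) (Pair x)) \<in> M \<rightarrow>\<^sub>M subprob_algebra (M \<Otimes>\<^sub>M N)"
    by (rule measurable_distr2[OF _ L]) simp
  from measurable_compose[OF this integral_measurable_subprob_algebra[OF f]]
  show ?thesis
  proof (rule measurable_cong[THEN iffD1, rotated])
    fix x assume x: "x \<in> space M"
    then have "Pair x \<in> L x \<rightarrow>\<^sub>M M \<Otimes>\<^sub>M N"
      using sets_kernel[OF L x] by (simp cong: measurable_cong_sets)
    then show "(\<integral>p. (case p of (x, y) \<Rightarrow> f x y) \<partial>distr (L x) (M \<Otimes>\<^sub>M N) (Pair x)) = (\<integral>y. f x y \<partial>L x)"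
      using f by (simp add: integral_distr)
  qed
qed

text \<open>
  Rounding \<open>f\<close> down to multiples of a small \<open>d\<close> gives a function with finitely many values, whose
  integral is a finite combination of measures of sets; the rounding error is at most \<open>d\<close> for all
  the probability measures simultaneously.
\<close>

lemma tendsto_integral_setwise:
  fixes f :: "'m \<Rightarrow> real"
  assumes f: "f \<in> borel_measurable N" and bound: "\<And>z. z \<in> space N \<Longrightarrow> \<bar>f z\<bar> \<le> K"
    and \<nu>: "prob_space \<nu>" "sets \<nu> = sets N"
    and \<mu>: "\<forall>\<^sub>F t in F. prob_space (\<mu> t) \<and> sets (\<mu> t) = sets N"
    and conv: "\<And>S. S \<in> sets N \<Longrightarrow> ((\<lambda>t. measure (\<mu> t) S) \<longlongrightarrow> measure \<nu> S) F"
  shows "((\<lambda>t. \<integral>z. f z \<partial>\<mu> t) \<longlongrightarrow> (\<integral>z. f z \<partial>\<nu>)) F"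
proof (rule tendstoI)
  fix e :: real assume "e > 0"
  \<comment> \<open>Rounding costs \<open>d\<close> for each of the two integrals, and the finite sums differ by less than \<open>d\<close>.\<close>
  define d where "d = e / 4"
  have d: "d > 0" using \<open>e > 0\<close> by (simp add: d_def)
  define B where "B k = {z \<in> space N. \<lfloor>f z / d\<rfloor> = k}" for k
  define I where "I = {\<lfloor>- K / d\<rfloor>..\<lfloor>K / d\<rfloor>}"
  define g where "g z = (\<Sum>k\<in>I. (d * real_of_int k) * indicator (B k) z)" for z
  have B: "B k \<in> sets N" for k unfolding B_def using f by measurable
  have gf: "\<bar>f z - g z\<bar> \<le> d" if z: "z \<in> space N" for z
  proof -
    have "- K / d \<le> f z / d" "f z / d \<le> K / d"
      using bound[OF z] d by (intro divide_right_mono; linarith)+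
    then have "\<lfloor>f z / d\<rfloor> \<in> I" by (auto simp: I_def intro!: floor_mono)
    then have "g z = d * real_of_int \<lfloor>f z / d\<rfloor>"
      unfolding g_def B_def using z by (subst sum.remove) (auto simp: I_def indicator_def)
    moreover have "d * real_of_int \<lfloor>f z / d\<rfloor> \<le> f z" "f z \<le> d * real_of_int \<lfloor>f z / d\<rfloor> + d"
      using floor_divide_lower[OF d, of "f z"] floor_divide_upper[OF d, of "f z"]
      by (auto simp: algebra_simps)
    ultimately show ?thesis by simp
  qed
  have int: "integrable M f" "(\<integral>z. g z \<partial>M) = (\<Sum>k\<in>I. (d * real_of_int k) * measure M (B k))"
    "\<bar>(\<integral>z. f z \<partial>M) - (\<integral>z. g z \<partial>M)\<bar> \<le> d" if M: "prob_space M" "sets M = sets N" for M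
  proof -
    interpret prob_space M by fact
    have sp: "space M = space N" using M(2) by (rule sets_eq_imp_space_eq)
    have fM: "f \<in> borel_measurable M" using f M(2) by (simp cong: measurable_cong_sets)
    show intf: "integrable M f"
      using bound fM by (intro integrable_const_bound[of _ K]) (auto simp: sp)
    have intB: "integrable M (\<lambda>z. (d * real_of_int k) * indicator (B k) z)" for k
      using B M(2) by (auto simp: emeasure_eq_measure intro!: integrable_mult_right)
    then have intg: "integrable M g" unfolding g_def by auto
    show "(\<integral>z. g z \<partial>M) = (\<Sum>k\<in>I. (d * real_of_int k) * measure M (B k))"
      unfolding g_def using intB B sets.sets_into_space[OF B] by (simp add: M(2) sp Int_absorb1 Int_absorb2)
    have "\<bar>(\<integral>z. f z \<partial>M) - (\<integral>z. g z \<partial>M)\<bar> = \<bar>\<integral>z. f z - g z \<partial>M\<bar>" using intf intg by simp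
    also have "\<dots> \<le> (\<integral>z. \<bar>f z - g z\<bar> \<partial>M)" by (rule integral_abs_bound)
    also have "\<dots> \<le> (\<integral>z. d \<partial>M)" using intf intg gf by (intro integral_mono) (auto simp: sp)
    finally show "\<bar>(\<integral>z. f z \<partial>M) - (\<integral>z. g z \<partial>M)\<bar> \<le> d" by (simp add: prob_space)
  qed
  have "((\<lambda>t. \<Sum>k\<in>I. (d * real_of_int k) * measure (\<mu> t) (B k)) \<longlongrightarrow>
      (\<Sum>k\<in>I. (d * real_of_int k) * measure \<nu> (B k))) F"
    by (intro tendsto_intros conv B)
  then have "\<forall>\<^sub>F t in F. dist (\<Sum>k\<in>I. (d * real_of_int k) * measure (\<mu> t) (B k))
      (\<Sum>k\<in>I. (d * real_of_int k) * measure \<nu> (B k)) < d"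
    using d by (rule tendstoD)
  with \<mu> show "\<forall>\<^sub>F t in F. dist (\<integral>z. f z \<partial>\<mu> t) (\<integral>z. f z \<partial>\<nu>) < e"
  proof eventually_elim
    case (elim t)
    then show ?case
      using int(2,3)[of "\<mu> t"] int(2,3)[OF \<nu>] d unfolding dist_real_def d_def by linarith
  qed
qed


section \<open>Powers and \<open>\<L>\<^sup>p\<close> norms\<close>

text \<open>
  The convention \<open>0 powr a = 0\<close> makes the left-hand side \<open>0\<close> at \<open>m = 0\<close>, also for \<open>r = 1\<close>.
\<close>

lemma powr_above_tangent:
  fixes r z m :: real
  assumes r: "r \<ge> 1" and z: "z \<ge> 0" and m: "m \<ge> 0"
  shows "m powr r + r * m powr (r - 1) * (z - m) \<le> z powr r"
proof (cases "m = 0 \<or> z = 0")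
  case True
  then show ?thesis
  proof
    assume "m = 0"
    then show ?thesis by simp
  next
    assume "z = 0"
    have "m powr (r - 1) * m = m powr r"
      using m by (cases "m = 0") (auto simp: powr_diff)
    then have "r * m powr (r - 1) * (z - m) = - (r * m powr r)"
      using \<open>z = 0\<close> by (simp only: diff_0 mult_minus_right mult.assoc)
    moreover have "1 * m powr r \<le> r * m powr r"
      using r by (intro mult_right_mono) auto
    ultimately show ?thesis using powr_ge_zero[of z r] by linarith
  qed
next
  case False
  then have "z > 0" "m > 0" using z m by auto
  moreover have "((\<lambda>x. x powr r) has_field_derivative (r * m powr (r - 1))) (at m within {0<..})"
    using \<open>m > 0\<close> by (auto intro!: derivative_eq_intros)
  ultimately have "r * m powr (r - 1) * (z - m) \<le> z powr r - m powr r"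
    using convex_on_imp_above_tangent[OF powr_convex[OF r], of m z]
    by (auto simp: interior_open is_interval_connected_1[symmetric])
  then show ?thesis by simp
qed

text \<open>
  Jensen's inequality for the power function and unnormalized weights: sum the tangent inequality
  at the weighted mean.
\<close>

lemma powr_weighted_sum_le:
  fixes a z :: "'j \<Rightarrow> real"
  assumes r: "r \<ge> 1" and a: "\<And>j. j \<in> J \<Longrightarrow> a j \<ge> 0" and z: "\<And>j. j \<in> J \<Longrightarrow> z j \<ge> 0"
    and J: "finite J"
  shows "(\<Sum>j\<in>J. a j * z j) powr r \<le> (\<Sum>j\<in>J. a j) powr (r - 1) * (\<Sum>j\<in>J. a j * z j powr r)"
proof (cases "(\<Sum>j\<in>J. a j) = 0")
  case True
  then have "\<forall>j\<in>J. a j = 0" using a J by (simp add: sum_nonneg_eq_0_iff)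
  then show ?thesis by simp
next
  case False
  define W where "W = (\<Sum>j\<in>J. a j)"
  have W: "W > 0" using False a sum_nonneg[of J a] by (auto simp: W_def less_le)
  define m where "m = (\<Sum>j\<in>J. a j * z j) / W"
  have m: "m \<ge> 0" using W a z by (auto simp: m_def intro!: divide_nonneg_pos sum_nonneg)
  have Wm: "(\<Sum>j\<in>J. a j * z j) = W * m" using W by (simp add: m_def)
  have "(\<Sum>j\<in>J. a j * (m powr r + r * m powr (r - 1) * (z j - m))) \<le> (\<Sum>j\<in>J. a j * z j powr r)"
    using r a z m by (intro sum_mono mult_left_mono powr_above_tangent) auto
  also have "(\<Sum>j\<in>J. a j * (m powr r + r * m powr (r - 1) * (z j - m)))
      = W * m powr r + r * m powr (r - 1) * ((\<Sum>j\<in>J. a j * z j) - W * m)"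
    by (simp add: W_def algebra_simps sum.distrib sum_subtractf sum_distrib_left sum_distrib_right)
  finally have "W * m powr r \<le> (\<Sum>j\<in>J. a j * z j powr r)" by (simp add: Wm)
  then have "W powr (r - 1) * (W * m powr r) \<le> W powr (r - 1) * (\<Sum>j\<in>J. a j * z j powr r)"
    by (intro mult_left_mono) auto
  moreover have "W powr (r - 1) * (W * m powr r) = (W * m) powr r"
    using W m by (simp add: powr_mult powr_diff)
  ultimately show ?thesis by (simp add: Wm W_def)
qed

text \<open>
  Integrate the tangent inequality at the mean of \<open>X\<close>.
\<close>

lemma (in prob_space) integral_powr_le:
  fixes X :: "'a \<Rightarrow> real"
  assumes r: "r \<ge> 1" and X: "X \<in> borel_measurable M"
    and bound: "\<And>z. z \<in> space M \<Longrightarrow> 0 \<le> X z \<and> X z \<le> K"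
  shows "(\<integral>z. X z \<partial>M) powr r \<le> (\<integral>z. X z powr r \<partial>M)"
proof -
  define m where "m = (\<integral>z. X z \<partial>M)"
  have intX: "integrable M X"
    using bound X by (intro integrable_const_bound[of _ K]) (auto intro!: AE_I2)
  have intXr: "integrable M (\<lambda>z. X z powr r)"
    using bound X r by (intro integrable_const_bound[of _ "K powr r"]) (auto intro!: AE_I2 powr_mono2)
  have m: "m \<ge> 0" unfolding m_def using bound by (intro Bochner_Integration.integral_nonneg) auto
  have "m powr r = (\<integral>z. m powr r + r * m powr (r - 1) * (X z - m) \<partial>M)"
    using intX by (simp add: prob_space m_def)
  also have "\<dots> \<le> (\<integral>z. X z powr r \<partial>M)"
    using intX intXr r m bound by (intro integral_mono powr_above_tangent) auto
  finally show ?thesis by (simp add: m_def)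
qed

text \<open>
  The assumption \<open>b \<ge> 0\<close> covers a null measure, where the essential supremum is \<open>-\<infinity>\<close> and is
  converted to \<open>0\<close>.
\<close>

lemma Lp_norm_top_le:
  assumes "(\<lambda>t. norm (g t)) \<in> borel_measurable M" and "AE t in M. norm (g t) \<le> b" and "b \<ge> 0"
  shows "Lp_norm \<infinity> M g \<le> b"
proof -
  have "esssup M (\<lambda>t. ereal (norm (g t))) \<le> ereal b"
    using assms(1,2) by (intro esssup_I) auto
  then show ?thesis
    using \<open>b \<ge> 0\<close> by (cases "esssup M (\<lambda>t. ereal (norm (g t)))") (auto simp: Lp_norm_def)
qed

text \<open>
  Boundedness excludes an infinite essential supremum, whose conversion to a real number would be
  \<open>0\<close>.
\<close>

lemma AE_le_Lp_norm_top:
  assumes "(\<lambda>t. norm (g t)) \<in> borel_measurable M" and "\<And>t. t \<in> space M \<Longrightarrow> norm (g t) \<le> b"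
  shows "AE t in M. norm (g t) \<le> Lp_norm \<infinity> M g"
proof -
  have "esssup M (\<lambda>t. ereal (norm (g t))) \<le> ereal b"
    using assms by (intro esssup_I) (auto intro!: AE_I2)
  moreover have "AE t in M. ereal (norm (g t)) \<le> esssup M (\<lambda>t. ereal (norm (g t)))"
    by (rule esssup_AE)
  ultimately show ?thesis
    by (cases "esssup M (\<lambda>t. ereal (norm (g t)))") (auto simp: Lp_norm_def)
qed

lemma Lp_norm_powr:
  assumes "r \<ge> 1"
  shows "(Lp_norm (ennreal r) M g) powr r = (\<integral>t. norm (g t) powr r \<partial>M)"
proof -
  have "(\<integral>t. norm (g t) powr r \<partial>M) \<ge> 0" by (intro Bochner_Integration.integral_nonneg) auto
  then show ?thesis using assms by (simp add: Lp_norm_def powr_powr)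
qed

lemma Lp_norm_le_iff:
  assumes r: "r \<ge> 1" and b: "b \<ge> 0"
  shows "Lp_norm (ennreal r) M g \<le> b \<longleftrightarrow> (\<integral>t. norm (g t) powr r \<partial>M) \<le> b powr r"
proof -
  have "Lp_norm (ennreal r) M g \<ge> 0" using r by (simp add: Lp_norm_def)
  then have "Lp_norm (ennreal r) M g \<le> b \<longleftrightarrow> Lp_norm (ennreal r) M g powr r \<le> b powr r"
    using r b powr_less_mono2[of r b "Lp_norm (ennreal r) M g"]
      powr_mono2[of r "Lp_norm (ennreal r) M g" b] by linarith
  then show ?thesis by (simp add: Lp_norm_powr[OF r])
qed


section \<open>Weighted row sums\<close>

lemma matrix_inv_eqI:
  fixes A B :: "'b::semiring_1^'n^'n"
  assumes "A ** B = mat 1" "B ** A = mat 1"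
  shows "matrix_inv A = B"
proof -
  have "A ** matrix_inv A = mat 1 \<and> matrix_inv A ** A = mat 1"
    unfolding matrix_inv_def
    using someI[of "\<lambda>A'. A ** A' = mat 1 \<and> A' ** A = mat 1" B] assms by blast
  then have "matrix_inv A = matrix_inv A ** (A ** B)" using assms by simp
  also have "\<dots> = (matrix_inv A ** A) ** B" by (rule matrix_mul_assoc)
  also have "\<dots> = B" using \<open>_ \<and> _\<close> by simp
  finally show ?thesis .
qed

lemma diag_matrix_mult: "(diag_matrix w ** A) $ i $ j = w i * A $ i $ j"
proof -
  have "(diag_matrix w ** A) $ i $ j = (\<Sum>k\<in>UNIV. if k = i then w i * A $ k $ j else 0)"
    unfolding matrix_matrix_mult_def diag_matrix_def vec_lambda_beta by (rule sum.cong) auto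
  then show ?thesis by simp
qed

lemma mult_diag_matrix: "(A ** diag_matrix w) $ i $ j = A $ i $ j * w j"
proof -
  have "(A ** diag_matrix w) $ i $ j = (\<Sum>k\<in>UNIV. if k = j then A $ i $ k * w j else 0)"
    unfolding matrix_matrix_mult_def diag_matrix_def vec_lambda_beta by (rule sum.cong) auto
  then show ?thesis by simp
qed

lemma matrix_inv_diag_matrix:
  fixes w :: "'n::finite \<Rightarrow> real"
  assumes "\<And>i. w i \<noteq> 0"
  shows "matrix_inv (diag_matrix w) = diag_matrix (\<lambda>i. 1 / w i)"
  using assms
  by (intro matrix_inv_eqI) (auto simp: vec_eq_iff diag_matrix_mult, auto simp: diag_matrix_def mat_def)

text \<open>
  The entry at \<open>(i, j)\<close> of the conjugated matrix is \<open>\<tau> i j / \<sigma> i * w j / w i\<close>.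
\<close>

lemma weighted_row_sum_le:
  fixes w \<sigma> :: "'n::finite \<Rightarrow> real"
  assumes w: "\<And>i. w i > 0"
  shows "(\<Sum>j\<in>- {i}. \<tau> i j / \<sigma> i * w j)
    \<le> matrix_inf_norm (matrix_inv (diag_matrix w) ** interaction_matrix \<sigma> \<tau> ** diag_matrix w) * w i"
    (is "_ \<le> matrix_inf_norm ?A * _")
proof -
  have entry: "?A $ i $ j = (if i = j then 0 else \<tau> i j / \<sigma> i * w j / w i)" for j
    using w[THEN less_imp_neq, THEN not_sym]
    by (simp add: matrix_inv_diag_matrix mult_diag_matrix diag_matrix_mult interaction_matrix_def)
  have "(\<Sum>j\<in>- {i}. \<tau> i j / \<sigma> i * w j) = (\<Sum>j\<in>- {i}. ?A $ i $ j * w i)"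
    using w[of i] by (intro sum.cong) (auto simp: entry)
  also have "\<dots> \<le> (\<Sum>j\<in>UNIV. \<bar>?A $ i $ j\<bar>) * w i"
    unfolding sum_distrib_right[symmetric] using w[of i]
    by (intro mult_right_mono order_trans[OF sum_mono sum_mono2]) auto
  also have "\<dots> \<le> matrix_inf_norm ?A * w i"
    unfolding matrix_inf_norm_def using w[of i] by (intro mult_right_mono Max_ge) auto
  finally show ?thesis .
qed


section \<open>Payoffs\<close>

lemma compact_PiE_UNIV:
  fixes X :: "'i \<Rightarrow> 'b::topological_space set"
  assumes "\<And>i. compact (X i)"
  shows "compact (PiE UNIV X)"
proof -
  have "compactin (product_topology (\<lambda>i. euclidean) UNIV) (PiE UNIV X)"
    using assms by (auto simp: compactin_PiE compactin_euclidean_iff)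
  then show ?thesis by (simp add: euclidean_product_topology compactin_euclidean_iff)
qed

lemma continuous_on_fun_upd_pair:
  "continuous_on UNIV (\<lambda>(x, a). (a :: 'i \<Rightarrow> 'b::topological_space)(i := x))"
  unfolding case_prod_unfold
proof (rule continuous_on_coordinatewise_then_product)
  fix j
  show "continuous_on UNIV (\<lambda>p. ((snd p)(i := fst p)) j :: 'b)"
  proof (cases "j = i")
    case True
    then show ?thesis by (simp add: continuous_on_fst)
  next
    case False
    then show ?thesis
      using continuous_on_compose2[OF continuous_on_product_coordinates[of j]
          continuous_on_snd[OF continuous_on_id]] by simp
  qed
qed

locale lipschitz_concave_game =
  fixes G :: "('i::finite, 'a::euclidean_space, 't::euclidean_space) game"
    and grad :: "'i \<Rightarrow> ('i \<Rightarrow> 'a) \<Rightarrow> ('i \<Rightarrow> 't) \<Rightarrow> 'a"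
    and \<sigma> :: "'i \<Rightarrow> real" and \<tau> :: "'i \<Rightarrow> 'i \<Rightarrow> real"
  assumes game: "bayesian_game G"
    and grad: "action_gradient G grad"
    and A: "assumption_A G grad"
    and B: "assumption_B G grad \<sigma> \<tau>"
begin

definition payoff :: "'i \<Rightarrow> ('i \<Rightarrow> 't \<Rightarrow> 'a) \<Rightarrow> 'a \<Rightarrow> 't \<Rightarrow> ('i \<Rightarrow> 't) \<Rightarrow> real" where
  "payoff i f x t s = util G i ((others i f s)(i := x)) (s(i := t))"

lemma expected_util_eq: "expected_util G i x f t = (\<integral>s. payoff i f x t s \<partial>cond G i t)"
  by (simp add: expected_util_def payoff_def)

lemma types: "types G i \<noteq> {}" "compact (types G i)"
  and actions: "actions G i \<noteq> {}" "compact (actions G i)" "convex (actions G i)"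
  using game by (auto simp: bayesian_game_def)

lemma \<sigma>_pos: "\<sigma> i > 0"
  using B by (auto simp: assumption_B_def)

lemma \<tau>_nonneg: "j \<noteq> i \<Longrightarrow> \<tau> i j \<ge> 0"
  using B by (auto simp: assumption_B_def)

lemma space_profile_algebra: "space (profile_algebra (types G) J) = PiE J (types G)"
  by (simp add: profile_algebra_def space_PiM space_restrict_space)

lemma
  assumes t: "t \<in> types G i"
  shows prob_space_cond: "prob_space (cond G i t)"
    and sets_cond: "sets (cond G i t) = sets (profile_algebra (types G) (- {i}))"
    and space_cond: "space (cond G i t) = PiE (- {i}) (types G)"
proof -
  show "prob_space (cond G i t)"
    and sets: "sets (cond G i t) = sets (profile_algebra (types G) (- {i}))"
    using game t by (auto simp: bayesian_game_def)
  show "space (cond G i t) = PiE (- {i}) (types G)"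
    using sets_eq_imp_space_eq[OF sets] by (simp add: space_profile_algebra)
qed

lemma measurable_cond:
  "cond G i \<in> borel_on (types G i) \<rightarrow>\<^sub>M prob_algebra (profile_algebra (types G) (- {i}))"
proof (rule measurable_prob_algebraI)
  show "cond G i \<in> borel_on (types G i) \<rightarrow>\<^sub>M subprob_algebra (profile_algebra (types G) (- {i}))"
  proof (rule measurable_subprob_algebra)
    fix S assume S: "S \<in> sets (profile_algebra (types G) (- {i}))"
    have "(\<lambda>t. ennreal (measure (cond G i t) S)) \<in> borel_measurable (borel_on (types G i))"
      using A S by (auto simp: assumption_A_def)
    then show "(\<lambda>t. emeasure (cond G i t) S) \<in> borel_measurable (borel_on (types G i))"
    proof (rule measurable_cong[THEN iffD1, rotated])
      fix t assume "t \<in> space (borel_on (types G i))"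
      then interpret prob_space "cond G i t" by (auto simp: space_restrict_space prob_space_cond)
      show "ennreal (measure (cond G i t) S) = emeasure (cond G i t) S"
        by (simp add: emeasure_eq_measure)
    qed
  qed (auto simp: space_restrict_space sets_cond prob_space_cond prob_space_imp_subprob_space)
qed (auto simp: space_restrict_space prob_space_cond)

lemma strategies_on_mono: "J \<subseteq> K \<Longrightarrow> strategies_on G K \<subseteq> strategies_on G J"
  by (auto simp: strategies_on_def)

lemma strategyD:
  assumes "f \<in> strategies_on G J" "j \<in> J"
  shows "f j \<in> borel_on (types G j) \<rightarrow>\<^sub>M borel" and "t \<in> types G j \<Longrightarrow> f j t \<in> actions G j"
  using assms measurable_space[of "f j" "borel_on (types G j)" "borel_on (actions G j)" t]
  by (auto simp: strategies_on_def measurable_restrict_space2_iff space_restrict_space)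

lemma others_in:
  assumes "f \<in> strategies_on G (- {i})" "s \<in> PiE (- {i}) (types G)"
  shows "others i f s \<in> PiE (- {i}) (actions G)"
  using strategyD(2)[OF assms(1)] assms(2) by (auto simp: others_def)

lemma profile_upd: "b \<in> PiE (- {i}) X \<Longrightarrow> x \<in> X i \<Longrightarrow> b(i := x) \<in> PiE UNIV X"
  by (auto simp: PiE_def Pi_def)

lemma continuous_on_util:
  "continuous_on (PiE UNIV (actions G) \<times> PiE UNIV (types G)) (\<lambda>(a, \<theta>). util G i a \<theta>)"
  using A by (auto simp: assumption_A_def)

lemma compact_profiles: "compact (PiE UNIV (actions G))" "compact (PiE UNIV (types G))"
  by (auto intro!: compact_PiE_UNIV types actions)

lemma payoff_bounded:
  "\<exists>K. \<forall>f\<in>strategies_on G (- {i}). \<forall>x\<in>actions G i. \<forall>t\<in>types G i. \<forall>s\<in>PiE (- {i}) (types G).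
     \<bar>payoff i f x t s\<bar> \<le> K"
proof -
  have "compact ((\<lambda>(a, \<theta>). util G i a \<theta>) ` (PiE UNIV (actions G) \<times> PiE UNIV (types G)))"
    by (intro compact_continuous_image continuous_on_util compact_Times compact_profiles)
  then obtain K where K: "\<And>y. y \<in> (\<lambda>(a, \<theta>). util G i a \<theta>) ` (PiE UNIV (actions G) \<times> PiE UNIV (types G))
      \<Longrightarrow> norm y \<le> K"
    using compact_imp_bounded bounded_iff by metis
  have "\<bar>payoff i f x t s\<bar> \<le> K" if f: "f \<in> strategies_on G (- {i})" and x: "x \<in> actions G i"
    and t: "t \<in> types G i" and s: "s \<in> PiE (- {i}) (types G)" for f x t s
  proof -
    have "((others i f s)(i := x), s(i := t)) \<in> PiE UNIV (actions G) \<times> PiE UNIV (types G)"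
      using profile_upd[OF others_in[OF f s] x] profile_upd[OF s t] by simp
    from K[OF imageI[OF this]] show ?thesis by (simp add: payoff_def)
  qed
  then show ?thesis by blast
qed

lemma payoff_measurable:
  assumes f: "f \<in> strategies_on G (- {i})" and x: "x \<in> actions G i"
  shows "(\<lambda>(t, s). payoff i f x t s)
    \<in> borel_measurable (borel_on (types G i) \<Otimes>\<^sub>M profile_algebra (types G) (- {i}))"
proof -
  let ?M = "borel_on (types G i) \<Otimes>\<^sub>M profile_algebra (types G) (- {i})"
  let ?h = "\<lambda>(t, s). ((others i f s)(i := x), s(i := t))"
  have sp: "space ?M = types G i \<times> PiE (- {i}) (types G)"
    by (simp add: space_pair_measure space_profile_algebra space_restrict_space)
  have coord: "(\<lambda>p. snd p j) \<in> ?M \<rightarrow>\<^sub>M borel_on (types G j)" if "j \<noteq> i" for j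
    using that unfolding profile_algebra_def
    by (intro measurable_compose[OF measurable_snd measurable_component_singleton]) auto
  have "(\<lambda>p. (others i f (snd p))(i := x)) \<in> ?M \<rightarrow>\<^sub>M borel"
  proof (rule measurable_coordinatewise_then_product)
    fix j
    show "(\<lambda>p. ((others i f (snd p))(i := x)) j) \<in> ?M \<rightarrow>\<^sub>M borel"
    proof (cases "j = i")
      case False
      then show ?thesis
        using measurable_compose[OF coord strategyD(1)[OF f]] by (simp add: others_def)
    qed simp
  qed
  moreover have "(\<lambda>p. (snd p)(i := fst p)) \<in> ?M \<rightarrow>\<^sub>M borel"
  proof (rule measurable_coordinatewise_then_product)
    fix j
    show "(\<lambda>p. ((snd p)(i := fst p)) j) \<in> ?M \<rightarrow>\<^sub>M borel"
    proof (cases "j = i")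
      case True
      have "fst \<in> ?M \<rightarrow>\<^sub>M borel_on (types G i)" by (rule measurable_fst)
      then show ?thesis using True by (simp add: measurable_restrict_space2_iff)
    next
      case False
      then show ?thesis using coord[OF False] by (simp add: measurable_restrict_space2_iff)
    qed
  qed
  ultimately have "?h \<in> ?M \<rightarrow>\<^sub>M borel"
    unfolding case_prod_unfold by (rule borel_measurable_Pair)
  then have "?h \<in> ?M \<rightarrow>\<^sub>M borel_on (PiE UNIV (actions G) \<times> PiE UNIV (types G))"
    using f x unfolding measurable_restrict_space2_iff sp by (auto intro!: profile_upd others_in)
  from measurable_compose[OF this borel_measurable_continuous_on_restrict[OF continuous_on_util[of i]]]
  show ?thesis by (simp add: payoff_def case_prod_unfold)
qed

lemma payoff_measurable_cond:
  assumes "f \<in> strategies_on G (- {i})" "x \<in> actions G i" "t \<in> types G i"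
  shows "payoff i f x t \<in> borel_measurable (profile_algebra (types G) (- {i}))"
  using measurable_compose[OF measurable_Pair1' payoff_measurable[OF assms(1,2)], of t] assms(3)
  by (simp add: space_restrict_space)

lemma integrable_payoff:
  assumes "f \<in> strategies_on G (- {i})" "x \<in> actions G i" "t \<in> types G i" "t' \<in> types G i"
  shows "integrable (cond G i t') (payoff i f x t)"
proof -
  interpret prob_space "cond G i t'" using assms by (simp add: prob_space_cond)
  obtain K where K: "\<forall>f\<in>strategies_on G (- {i}). \<forall>x\<in>actions G i. \<forall>t\<in>types G i. \<forall>s\<in>PiE (- {i}) (types G).
     \<bar>payoff i f x t s\<bar> \<le> K"
    using payoff_bounded by blast
  have "payoff i f x t \<in> borel_measurable (cond G i t')"
    using payoff_measurable_cond[OF assms(1-3)] sets_cond[OF assms(4)] by (simp cong: measurable_cong_sets)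
  then show ?thesis
    using assms by (intro integrable_const_bound[of _ K]) (use K in \<open>auto simp: space_cond intro!: AE_I2\<close>)
qed

text \<open>
  The payoff is the utility at a profile whose \<open>i\<close>-th components are overwritten by \<open>x\<close> and \<open>t\<close>.
  As a function of \<open>x\<close>, \<open>t\<close> and the whole profile it is continuous on a compact space, so the modulus
  of continuity in \<open>(x, t)\<close> is independent of the profile, in particular of the strategies \<open>f\<close> and
  of the opponents' types.
\<close>

lemma payoff_uniformly_continuous:
  assumes "e > 0"
  shows "\<exists>\<delta>>0. \<forall>f\<in>strategies_on G (- {i}). \<forall>s\<in>PiE (- {i}) (types G).
    \<forall>x\<in>actions G i. \<forall>x'\<in>actions G i. \<forall>t\<in>types G i. \<forall>t'\<in>types G i.
      dist (x', t') (x, t) < \<delta> \<longrightarrow> \<bar>payoff i f x' t' s - payoff i f x t s\<bar> < e"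
proof -
  let ?P = "PiE UNIV (actions G) \<times> PiE UNIV (types G)"
  let ?S = "(actions G i \<times> types G i) \<times> ?P"
  define w :: "('a \<times> 't) \<times> ('i \<Rightarrow> 'a) \<times> ('i \<Rightarrow> 't) \<Rightarrow> ('i \<Rightarrow> 'a) \<times> ('i \<Rightarrow> 't)"
    where "w p = ((fst (snd p))(i := fst (fst p)), (snd (snd p))(i := snd (fst p)))" for p
  let ?U = "\<lambda>p. (\<lambda>(a, \<theta>). util G i a \<theta>) (w p)"
  have "continuous_on ?S (\<lambda>p. (\<lambda>(x, a). a(i := x)) (fst (fst p), fst (snd p)))"
    by (rule continuous_on_compose2[OF continuous_on_fun_upd_pair],
        intro continuous_on_Pair continuous_on_fst continuous_on_snd continuous_on_id) simp
  moreover have "continuous_on ?S (\<lambda>p. (\<lambda>(x, a). a(i := x)) (snd (fst p), snd (snd p)))"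
    by (rule continuous_on_compose2[OF continuous_on_fun_upd_pair],
        intro continuous_on_Pair continuous_on_fst continuous_on_snd continuous_on_id) simp
  ultimately have "continuous_on ?S w"
    unfolding w_def by (intro continuous_on_Pair) simp_all
  moreover have "w ` ?S \<subseteq> ?P"
    by (auto simp: w_def)
  ultimately have "continuous_on ?S ?U"
    by (intro continuous_on_compose2[OF continuous_on_util])
  then have "uniformly_continuous_on ?S ?U"
    by (intro compact_uniformly_continuous compact_Times types actions compact_profiles)
  then obtain \<delta> where "\<delta> > 0" and \<delta>: "\<And>p q. p \<in> ?S \<Longrightarrow> q \<in> ?S \<Longrightarrow> dist q p < \<delta> \<Longrightarrow>
      dist (?U q) (?U p) < e"
    using \<open>e > 0\<close> unfolding uniformly_continuous_on_def by metis
  have "\<bar>payoff i f x' t' s - payoff i f x t s\<bar> < e"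
    if f: "f \<in> strategies_on G (- {i})" and s: "s \<in> PiE (- {i}) (types G)"
      and x: "x \<in> actions G i" "x' \<in> actions G i" and t: "t \<in> types G i" "t' \<in> types G i"
      and d: "dist (x', t') (x, t) < \<delta>" for f s x x' t t'
  proof -
    define P where "P = ((others i f s)(i := x), s(i := t))"
    have "P \<in> ?P"
      using profile_upd[OF others_in[OF f s] x(1)] profile_upd[OF s t(1)] by (simp add: P_def)
    moreover have "dist ((x', t'), P) ((x, t), P) < \<delta>"
      using d by (simp add: dist_Pair_Pair)
    ultimately have "dist (?U ((x', t'), P)) (?U ((x, t), P)) < e"
      using x t by (intro \<delta>) auto
    then show ?thesis
      by (simp add: w_def P_def payoff_def dist_real_def)
  qed
  then show ?thesis using \<open>\<delta> > 0\<close> by blast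
qed

lemma util_gradient:
  assumes "b \<in> PiE (- {i}) (actions G)" "x \<in> actions G i" "\<theta> \<in> PiE UNIV (types G)"
  shows "((\<lambda>x. util G i (b(i := x)) \<theta>) has_derivative (\<lambda>h. grad i (b(i := x)) \<theta> \<bullet> h))
    (at x within actions G i)"
proof -
  have "((\<lambda>y. util G i ((b(i := x))(i := y)) \<theta>) has_derivative (\<lambda>h. grad i (b(i := x)) \<theta> \<bullet> h))
      (at ((b(i := x)) i) within actions G i)"
    using grad profile_upd[OF assms(1,2)] assms(3) unfolding action_gradient_def by blast
  then show ?thesis by simp
qed

lemma payoff_strongly_concave:
  assumes f: "f \<in> strategies_on G (- {i})" and s: "s \<in> PiE (- {i}) (types G)" and t: "t \<in> types G i"
  shows "strongly_concave_on (actions G i) (\<sigma> i) (\<lambda>x. payoff i f x t s)"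
  unfolding payoff_def
proof (rule strongly_concave_on_gradientI[OF actions(3)])
  note [simp] = others_in[OF f s] profile_upd[OF s t]
  show "((\<lambda>x. util G i ((others i f s)(i := x)) (s(i := t))) has_derivative
      (\<lambda>h. grad i ((others i f s)(i := x)) (s(i := t)) \<bullet> h)) (at x within actions G i)"
    if "x \<in> actions G i" for x
    using that by (intro util_gradient) auto
  show "(grad i ((others i f s)(i := x)) (s(i := t)) - grad i ((others i f s)(i := y)) (s(i := t)))
      \<bullet> (x - y) \<le> - \<sigma> i * (norm (x - y))\<^sup>2" if "x \<in> actions G i" "y \<in> actions G i" for x y
    using B that unfolding assumption_B_def by auto
qed

text \<open>
  The difference of the payoffs against \<open>f\<close> and \<open>g\<close>, as a function of the own action, has a gradient
  of norm at most the sum on the right; apply the mean value theorem on the convex action set.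
\<close>

lemma payoff_difference_lipschitz:
  assumes f: "f \<in> strategies_on G (- {i})" and g: "g \<in> strategies_on G (- {i})"
    and s: "s \<in> PiE (- {i}) (types G)" and t: "t \<in> types G i"
    and x: "x \<in> actions G i" and y: "y \<in> actions G i"
  shows "(payoff i f x t s - payoff i g x t s) - (payoff i f y t s - payoff i g y t s)
    \<le> (\<Sum>j\<in>- {i}. \<tau> i j * norm (f j (s j) - g j (s j))) * norm (x - y)"
proof -
  define L where "L = (\<Sum>j\<in>- {i}. \<tau> i j * norm (f j (s j) - g j (s j)))"
  note [simp] = others_in[OF f s] others_in[OF g s] profile_upd[OF s t]
  define \<Delta> where "\<Delta> z = grad i ((others i f s)(i := z)) (s(i := t)) - grad i ((others i g s)(i := z)) (s(i := t))" for z
  define v where "v z = payoff i f z t s - payoff i g z t s" for z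
  have "norm (v x - v y) \<le> L * norm (x - y)"
  proof (rule differentiable_bound[OF actions(3) _ _ x y])
    fix z assume z: "z \<in> actions G i"
    show "(v has_derivative (\<lambda>h. \<Delta> z \<bullet> h)) (at z within actions G i)"
      unfolding v_def payoff_def \<Delta>_def inner_diff_left
      using z by (intro has_derivative_diff util_gradient) auto
    have "norm (\<Delta> z) \<le> (\<Sum>j\<in>- {i}. \<tau> i j * norm (others i f s j - others i g s j))"
      using B z unfolding assumption_B_def \<Delta>_def by auto
    also have "\<dots> = L" by (simp add: L_def others_def)
    finally show "onorm (\<lambda>h. \<Delta> z \<bullet> h) \<le> L"
      by (intro onorm_le) (smt (verit) Cauchy_Schwarz_ineq2 mult_right_mono norm_ge_zero real_norm_def)
  qed
  then show ?thesis by (simp add: v_def L_def)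
qed


section \<open>Best responses\<close>

lemma expected_util_strongly_concave:
  assumes "f \<in> strategies_on G (- {i})" "t \<in> types G i"
  shows "strongly_concave_on (actions G i) (\<sigma> i) (\<lambda>x. expected_util G i x f t)"
  unfolding expected_util_eq
  using assms by (intro strongly_concave_on_integral)
    (auto simp: space_cond prob_space_cond actions intro!: payoff_strongly_concave integrable_payoff)

text \<open>
  Both integrals are taken under the conditional law of \<open>t'\<close>: this isolates the effect of moving
  \<open>(x, t)\<close> inside the integrand from the effect of changing the law.
\<close>

lemma expected_util_close:
  assumes f: "f \<in> strategies_on G (- {i})" and x: "x \<in> actions G i" "x' \<in> actions G i"
    and t: "t \<in> types G i" "t' \<in> types G i"
    and close: "\<And>s. s \<in> PiE (- {i}) (types G) \<Longrightarrow> \<bar>payoff i f x' t' s - payoff i f x t s\<bar> < e"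
  shows "\<bar>expected_util G i x' f t' - (\<integral>s. payoff i f x t s \<partial>cond G i t')\<bar> \<le> e"
proof -
  interpret prob_space "cond G i t'" using t by (simp add: prob_space_cond)
  have int: "integrable (cond G i t') (payoff i f x' t')" "integrable (cond G i t') (payoff i f x t)"
    using assms by (auto intro!: integrable_payoff)
  have "\<bar>expected_util G i x' f t' - (\<integral>s. payoff i f x t s \<partial>cond G i t')\<bar>
      = \<bar>\<integral>s. payoff i f x' t' s - payoff i f x t s \<partial>cond G i t'\<bar>"
    using int by (simp add: expected_util_eq)
  also have "\<dots> \<le> (\<integral>s. \<bar>payoff i f x' t' s - payoff i f x t s\<bar> \<partial>cond G i t')"
    by (rule integral_abs_bound)
  also have "\<dots> \<le> (\<integral>s. e \<partial>cond G i t')"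
    using int close t by (intro integral_mono) (auto simp: space_cond less_imp_le)
  finally show ?thesis by (simp add: prob_space)
qed

lemma continuous_on_expected_util:
  assumes f: "f \<in> strategies_on G (- {i})" and t: "t \<in> types G i"
  shows "continuous_on (actions G i) (\<lambda>x. expected_util G i x f t)"
  unfolding continuous_on_iff
proof (intro ballI allI impI)
  fix x and e :: real assume x: "x \<in> actions G i" and "e > 0"
  then have "e / 2 > 0" by simp
  from payoff_uniformly_continuous[OF this, of i] f x t obtain \<delta> where "\<delta> > 0"
    and \<delta>: "\<And>x' s. x' \<in> actions G i \<Longrightarrow> s \<in> PiE (- {i}) (types G) \<Longrightarrow> dist (x', t) (x, t) < \<delta> \<Longrightarrow>
      \<bar>payoff i f x' t s - payoff i f x t s\<bar> < e / 2"
    by blast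
  have "dist (expected_util G i x' f t) (expected_util G i x f t) < e"
    if "x' \<in> actions G i" "dist x' x < \<delta>" for x'
    using expected_util_close[OF f x that(1) t t \<delta>[OF that(1)]] that(2) \<open>e > 0\<close>
    by (simp add: dist_Pair_Pair dist_real_def expected_util_eq)
  then show "\<exists>\<delta>>0. \<forall>x'\<in>actions G i. dist x' x < \<delta> \<longrightarrow>
      dist (expected_util G i x' f t) (expected_util G i x f t) < e"
    using \<open>\<delta> > 0\<close> by blast
qed

lemma best_response_growth:
  assumes "f \<in> strategies_on G (- {i})" "t \<in> types G i" "is_best_response G i f t x"
  shows "growth_maximizer (actions G i) (\<sigma> i) (\<lambda>x. expected_util G i x f t) x"
  using assms by (intro strongly_concave_on_maximizer_growth expected_util_strongly_concave actions)
    (auto simp: is_best_response_def is_arg_max_linorder)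

lemma best_response_unique:
  assumes f: "f \<in> strategies_on G (- {i})" and t: "t \<in> types G i"
  shows "\<exists>!x. is_best_response G i f t x"
proof -
  obtain x where "x \<in> actions G i" "\<forall>y\<in>actions G i. expected_util G i y f t \<le> expected_util G i x f t"
    using continuous_attains_sup[OF actions(2,1) continuous_on_expected_util[OF assms]] by blast
  then have "is_best_response G i f t x" by (auto simp: is_best_response_def is_arg_max_linorder)
  moreover have "y = z" if "is_best_response G i f t y" "is_best_response G i f t z" for y z
    using growth_maximizer_stability[OF best_response_growth[OF assms that(1)] best_response_growth[OF assms that(2)]]
      \<sigma>_pos[of i] by (auto simp: mult_le_0_iff not_le)
  ultimately show ?thesis by blast
qed

lemma best_response_iff:
  assumes "f \<in> strategies_on G (- {i})" "t \<in> types G i"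
  shows "is_best_response G i f t x \<longleftrightarrow> x = response G f i t"
  using theI'[OF best_response_unique[OF assms]] best_response_unique[OF assms]
  unfolding response_def by blast

lemma response_growth:
  assumes "f \<in> strategies_on G (- {i})" "t \<in> types G i"
  shows "growth_maximizer (actions G i) (\<sigma> i) (\<lambda>x. expected_util G i x f t) (response G f i t)"
  using best_response_growth[OF assms] best_response_iff[OF assms] by blast

lemma response_in_actions:
  assumes "f \<in> strategies_on G (- {i})" "t \<in> types G i"
  shows "response G f i t \<in> actions G i"
  using response_growth[OF assms] by (simp add: growth_maximizer_def)

lemma response_measurable:
  assumes f: "f \<in> strategies_on G (- {i})"
  shows "response G f i \<in> borel_on (types G i) \<rightarrow>\<^sub>M borel_on (actions G i)"
proof -
  have "response G f i \<in> borel_measurable (borel_on (types G i))"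
  proof (rule measurable_growth_maximizer[OF \<sigma>_pos])
    fix x assume "x \<in> actions G i"
    then show "expected_util G i x f \<in> borel_measurable (borel_on (types G i))"
      unfolding expected_util_eq[abs_def]
      using measurable_integral_kernel[OF payoff_measurable[OF f]] measurable_cond
      by (blast intro: measurable_prob_algebraD)
  qed (auto simp: space_restrict_space intro!: f continuous_on_expected_util response_growth)
  then show ?thesis
    using response_in_actions[OF f] by (auto simp: measurable_restrict_space2_iff space_restrict_space)
qed

lemma response_in_strategies: "f \<in> strategies G \<Longrightarrow> response G f \<in> strategies G"
  using strategies_on_mono[of "- {_}" UNIV] response_measurable by (force simp: strategies_on_def)


section \<open>Disintegration of the prior along one coordinate\<close>

text \<open>
  The conditional law of \<open>\<theta>\<^sub>j\<close> given \<open>\<theta>\<^sub>i = t\<close>. The estimates below involve the opponents one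
  at a time, so only these laws of single coordinates enter.
\<close>

definition coord_cond :: "'i \<Rightarrow> 'i \<Rightarrow> 't \<Rightarrow> 't measure" where
  "coord_cond i j t = distr (cond G i t) (borel_on (types G j)) (\<lambda>s. s j)"

lemma measurable_coord:
  assumes "j \<in> J"
  shows "(\<lambda>s. s j) \<in> profile_algebra (types G) J \<rightarrow>\<^sub>M borel_on (types G j)"
  using assms unfolding profile_algebra_def by (rule measurable_component_singleton)

lemma measurable_coord_cond:
  "j \<noteq> i \<Longrightarrow> coord_cond i j \<in> borel_on (types G i) \<rightarrow>\<^sub>M prob_algebra (borel_on (types G j))"
  unfolding coord_cond_def
  by (rule measurable_compose[OF measurable_cond measurable_distr_prob_space[OF measurable_coord]]) auto

lemma
  assumes "j \<noteq> i" "t \<in> types G i"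
  shows prob_space_coord_cond: "prob_space (coord_cond i j t)"
    and sets_coord_cond: "sets (coord_cond i j t) = sets (borel_on (types G j))"
    and space_coord_cond: "space (coord_cond i j t) = types G j"
  using measurable_space[OF measurable_coord_cond[OF assms(1)], of t] assms(2)
  by (auto simp: space_restrict_space space_prob_algebra coord_cond_def)

lemma
  shows prob_space_marginal: "prob_space (marginal G i)"
    and sets_marginal: "sets (marginal G i) = sets (borel_on (types G i))"
    and space_marginal: "space (marginal G i) = types G i"
proof -
  interpret prob_space "prior G" using game by (simp add: bayesian_game_def)
  have "sets (prior G) = sets (profile_algebra (types G) UNIV)"
    using game by (simp add: bayesian_game_def)
  then have "(\<lambda>\<theta>. \<theta> i) \<in> prior G \<rightarrow>\<^sub>M borel_on (types G i)"
    using measurable_coord[of i UNIV] by (simp cong: measurable_cong_sets)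
  then show "prob_space (marginal G i)"
    unfolding marginal_def by (rule prob_space_distr)
qed (auto simp: marginal_def space_restrict_space)

text \<open>
  The law of total probability: the disintegration of the prior, applied to the set of profiles whose
  \<open>j\<close>-th component lies in a given set and with no restriction on the own type.
\<close>

lemma marginal_eq_bind:
  assumes ij: "j \<noteq> i"
  shows "marginal G j = marginal G i \<bind> coord_cond i j"
proof (rule measure_eqI)
  have ker: "coord_cond i j \<in> marginal G i \<rightarrow>\<^sub>M subprob_algebra (borel_on (types G j))"
    using measurable_prob_algebraD[OF measurable_coord_cond[OF ij]]
    by (simp add: sets_marginal cong: measurable_cong_sets)
  have ne: "space (marginal G i) \<noteq> {}" using types by (simp add: space_marginal)
  show "sets (marginal G j) = sets (marginal G i \<bind> coord_cond i j)"
    using ij types by (subst sets_bind[where N = "borel_on (types G j)"])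
      (auto simp: sets_marginal space_marginal sets_coord_cond)
  fix C assume "C \<in> sets (marginal G j)"
  then have C: "C \<in> sets (borel_on (types G j))" by (simp add: sets_marginal)
  define S where "S = {s \<in> PiE (- {i}) (types G). s j \<in> C}"
  have S: "S = (\<lambda>s. s j) -` C \<inter> space (profile_algebra (types G) (- {i}))"
    by (auto simp: S_def space_profile_algebra)
  then have S_sets: "S \<in> sets (profile_algebra (types G) (- {i}))"
    using measurable_sets[OF measurable_coord C] ij by simp
  have prior: "sets (prior G) = sets (profile_algebra (types G) UNIV)"
    using game by (simp add: bayesian_game_def)
  have T: "types G i \<in> sets (borel_on (types G i))"
    using sets.top[of "borel_on (types G i)"] by (simp add: space_restrict_space)
  have "emeasure (marginal G j) C = emeasure (prior G) ((\<lambda>\<theta>. \<theta> j) -` C \<inter> space (prior G))"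
    unfolding marginal_def using C measurable_coord[of j UNIV] prior
    by (intro emeasure_distr) (simp_all cong: measurable_cong_sets)
  also have "(\<lambda>\<theta>. \<theta> j) -` C \<inter> space (prior G)
      = {\<theta> \<in> PiE UNIV (types G). \<theta> i \<in> types G i \<and> restrict \<theta> (- {i}) \<in> S}"
    using ij sets_eq_imp_space_eq[OF prior] by (auto simp: S_def space_profile_algebra)
  also have "emeasure (prior G) \<dots> = (\<integral>\<^sup>+ t \<in> types G i. emeasure (cond G i t) S \<partial>marginal G i)"
    using game S_sets T unfolding bayesian_game_def by blast
  also have "\<dots> = (\<integral>\<^sup>+ t. emeasure (coord_cond i j t) C \<partial>marginal G i)"
  proof (rule nn_integral_cong)
    fix t assume "t \<in> space (marginal G i)"
    then have t: "t \<in> types G i" by (simp add: space_marginal)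
    have "emeasure (coord_cond i j t) C = emeasure (cond G i t) ((\<lambda>s. s j) -` C \<inter> space (cond G i t))"
      unfolding coord_cond_def using C measurable_coord[of j "- {i}"] ij sets_cond[OF t]
      by (intro emeasure_distr) (simp_all cong: measurable_cong_sets)
    also have "(\<lambda>s. s j) -` C \<inter> space (cond G i t) = S"
      using space_cond[OF t] by (auto simp: S_def)
    finally show "emeasure (cond G i t) S * indicator (types G i) t = emeasure (coord_cond i j t) C"
      using t by simp
  qed
  also have "\<dots> = emeasure (marginal G i \<bind> coord_cond i j) C"
    by (rule emeasure_bind[OF ne ker C, symmetric])
  finally show "emeasure (marginal G j) C = emeasure (marginal G i \<bind> coord_cond i j) C" .
qed

lemma AE_marginal_iff:
  assumes ij: "j \<noteq> i" and P: "Measurable.pred (borel_on (types G j)) P"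
  shows "(AE u in marginal G j. P u) \<longleftrightarrow> (AE t in marginal G i. AE u in coord_cond i j t. P u)"
proof -
  have "coord_cond i j \<in> marginal G i \<rightarrow>\<^sub>M subprob_algebra (borel_on (types G j))"
    using measurable_prob_algebraD[OF measurable_coord_cond[OF ij]]
    by (simp add: sets_marginal cong: measurable_cong_sets)
  from AE_bind[OF this P] show ?thesis unfolding marginal_eq_bind[OF ij] .
qed

lemma integral_marginal:
  fixes h :: "'t \<Rightarrow> real"
  assumes ij: "j \<noteq> i" and h: "h \<in> borel_measurable (borel_on (types G j))"
    and bound: "\<And>u. u \<in> types G j \<Longrightarrow> 0 \<le> h u \<and> h u \<le> K"
  shows "integrable (marginal G i) (\<lambda>t. \<integral>u. h u \<partial>coord_cond i j t)"
    and "(\<integral>t. \<integral>u. h u \<partial>coord_cond i j t \<partial>marginal G i) = (\<integral>u. h u \<partial>marginal G j)"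
proof -
  have int: "integrable M h" and nn: "(\<integral>\<^sup>+u. h u \<partial>M) = ennreal (\<integral>u. h u \<partial>M)"
    and range: "0 \<le> (\<integral>u. h u \<partial>M)" "(\<integral>u. h u \<partial>M) \<le> K"
    if "prob_space M" "sets M = sets (borel_on (types G j))" for M
  proof -
    interpret prob_space M by fact
    have sp: "space M = types G j"
      using sets_eq_imp_space_eq[OF that(2)] by (simp add: space_restrict_space)
    have "h \<in> borel_measurable M" using h that(2) by (simp cong: measurable_cong_sets)
    then show int: "integrable M h"
      using bound by (intro integrable_const_bound[of _ K]) (auto intro!: AE_I2 simp: sp)
    then show "(\<integral>\<^sup>+u. h u \<partial>M) = ennreal (\<integral>u. h u \<partial>M)"
      using bound by (intro nn_integral_eq_integral) (auto intro!: AE_I2 simp: sp)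
    show "0 \<le> (\<integral>u. h u \<partial>M)" using bound by (intro Bochner_Integration.integral_nonneg) (auto simp: sp)
    have "(\<integral>u. h u \<partial>M) \<le> (\<integral>u. K \<partial>M)" using int bound by (intro integral_mono) (auto simp: sp)
    then show "(\<integral>u. h u \<partial>M) \<le> K" by (simp add: prob_space)
  qed
  interpret mi: prob_space "marginal G i" by (rule prob_space_marginal)
  have ker: "coord_cond i j \<in> marginal G i \<rightarrow>\<^sub>M subprob_algebra (borel_on (types G j))"
    using measurable_prob_algebraD[OF measurable_coord_cond[OF ij]]
    by (simp add: sets_marginal cong: measurable_cong_sets)
  note coord = prob_space_coord_cond[OF ij] sets_coord_cond[OF ij]
  have "(\<lambda>t. \<integral>u. h u \<partial>coord_cond i j t) \<in> borel_measurable (marginal G i)"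
    using measurable_compose[OF ker integral_measurable_subprob_algebra[OF h]] .
  then show I: "integrable (marginal G i) (\<lambda>t. \<integral>u. h u \<partial>coord_cond i j t)"
    using range[OF coord] by (intro mi.integrable_const_bound[of _ K]) (auto intro!: AE_I2 simp: space_marginal)
  have "ennreal (\<integral>u. h u \<partial>marginal G j) = (\<integral>\<^sup>+u. h u \<partial>(marginal G i \<bind> coord_cond i j))"
    using nn[OF prob_space_marginal sets_marginal] by (simp add: marginal_eq_bind[OF ij])
  also have "\<dots> = (\<integral>\<^sup>+t. \<integral>\<^sup>+u. h u \<partial>coord_cond i j t \<partial>marginal G i)"
    using h by (intro nn_integral_bind[OF _ ker]) simp
  also have "\<dots> = (\<integral>\<^sup>+t. ennreal (\<integral>u. h u \<partial>coord_cond i j t) \<partial>marginal G i)"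
    by (intro nn_integral_cong nn coord) (auto simp: space_marginal)
  also have "\<dots> = ennreal (\<integral>t. \<integral>u. h u \<partial>coord_cond i j t \<partial>marginal G i)"
    using range(1)[OF coord] by (intro nn_integral_eq_integral[OF I]) (auto intro!: AE_I2 simp: space_marginal)
  finally have "ennreal (\<integral>u. h u \<partial>marginal G j) = ennreal (\<integral>t. \<integral>u. h u \<partial>coord_cond i j t \<partial>marginal G i)" .
  moreover have "0 \<le> (\<integral>t. \<integral>u. h u \<partial>coord_cond i j t \<partial>marginal G i)"
    by (intro Bochner_Integration.integral_nonneg range(1)[OF coord]) (simp_all add: space_marginal)
  ultimately show "(\<integral>t. \<integral>u. h u \<partial>coord_cond i j t \<partial>marginal G i) = (\<integral>u. h u \<partial>marginal G j)"
    using range(1)[OF prob_space_marginal sets_marginal] by simp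
qed


section \<open>Dependence of best responses on strategies and types\<close>

lemma strategy_diff_measurable:
  assumes "f \<in> strategies_on G J" "g \<in> strategies_on G J" "j \<in> J"
  shows "(\<lambda>u. norm (f j u - g j u)) \<in> borel_measurable (borel_on (types G j))"
  using strategyD(1)[OF assms(1,3)] strategyD(1)[OF assms(2,3)] by measurable

lemma strategy_diff_bounded:
  "\<exists>K. \<forall>j. \<forall>f\<in>strategies_on G {j}. \<forall>g\<in>strategies_on G {j}. \<forall>u\<in>types G j. norm (f j u - g j u) \<le> K"
proof -
  have "bounded (\<Union>j. actions G j)" by (intro bounded_UN) (auto intro: compact_imp_bounded actions)
  then obtain K where K: "\<And>j x. x \<in> actions G j \<Longrightarrow> norm x \<le> K" unfolding bounded_iff by blast
  have "norm (f j u - g j u) \<le> K + K"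
    if "f \<in> strategies_on G {j}" "g \<in> strategies_on G {j}" "u \<in> types G j" for f g j u
    using K[OF strategyD(2)[OF that(1) _ that(3)]] K[OF strategyD(2)[OF that(2) _ that(3)]]
    by (intro order_trans[OF norm_triangle_ineq4] add_mono) auto
  then show ?thesis by blast
qed

text \<open>
  Stability of maximizers bounds \<open>\<sigma> i * |x - y|\<^sup>2\<close> by an increment of the difference of expected
  utilities, and \<open>payoff_difference_lipschitz\<close> bounds that increment by a multiple of \<open>|x - y|\<close>. One
  factor \<open>|x - y|\<close> cancels.
\<close>

lemma response_lipschitz:
  assumes f: "f \<in> strategies_on G (- {i})" and g: "g \<in> strategies_on G (- {i})" and t: "t \<in> types G i"
  shows "norm (response G f i t - response G g i t)
    \<le> (\<Sum>j\<in>- {i}. \<tau> i j / \<sigma> i * (\<integral>u. norm (f j u - g j u) \<partial>coord_cond i j t))"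
proof -
  interpret prob_space "cond G i t" using t by (rule prob_space_cond)
  define x where "x = response G f i t"
  define y where "y = response G g i t"
  have x: "x \<in> actions G i" and y: "y \<in> actions G i"
    using f g t by (auto simp: x_def y_def intro: response_in_actions)
  obtain K where K: "\<And>j f g u. f \<in> strategies_on G {j} \<Longrightarrow> g \<in> strategies_on G {j} \<Longrightarrow> u \<in> types G j \<Longrightarrow>
      norm (f j u - g j u) \<le> K"
    using strategy_diff_bounded by blast
  have coord: "(\<lambda>s. s j) \<in> cond G i t \<rightarrow>\<^sub>M borel_on (types G j)" if "j \<noteq> i" for j
    using measurable_coord[of j "- {i}"] that sets_cond[OF t] by (simp cong: measurable_cong_sets)
  have int: "integrable (cond G i t) (\<lambda>s. norm (f j (s j) - g j (s j)))"
    and eq: "(\<integral>s. norm (f j (s j) - g j (s j)) \<partial>cond G i t) = (\<integral>u. norm (f j u - g j u) \<partial>coord_cond i j t)"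
    if j: "j \<noteq> i" for j
  proof -
    have meas: "(\<lambda>u. norm (f j u - g j u)) \<in> borel_measurable (borel_on (types G j))"
      using f g j by (intro strategy_diff_measurable[of f "- {i}"]) auto
    have "f \<in> strategies_on G {j}" "g \<in> strategies_on G {j}"
      using f g j strategies_on_mono[of "{j}" "- {i}"] by auto
    then show "integrable (cond G i t) (\<lambda>s. norm (f j (s j) - g j (s j)))"
      using K[of f j g] measurable_compose[OF coord[OF j] meas] space_cond[OF t] j
      by (intro integrable_const_bound[of _ K]) (auto intro!: AE_I2)
    show "(\<integral>s. norm (f j (s j) - g j (s j)) \<partial>cond G i t) = (\<integral>u. norm (f j u - g j u) \<partial>coord_cond i j t)"
      unfolding coord_cond_def using integral_distr[OF coord[OF j] meas] by simp
  qed
  have "\<sigma> i * (norm (x - y))\<^sup>2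
      \<le> (expected_util G i x f t - expected_util G i x g t) - (expected_util G i y f t - expected_util G i y g t)"
    unfolding x_def y_def by (rule growth_maximizer_stability[OF response_growth[OF f t] response_growth[OF g t]])
  also have "\<dots> = (\<integral>s. (payoff i f x t s - payoff i g x t s) - (payoff i f y t s - payoff i g y t s) \<partial>cond G i t)"
    using integrable_payoff[OF f x t t] integrable_payoff[OF f y t t]
      integrable_payoff[OF g x t t] integrable_payoff[OF g y t t] by (simp add: expected_util_eq)
  also have "\<dots> \<le> (\<integral>s. (\<Sum>j\<in>- {i}. \<tau> i j * norm (f j (s j) - g j (s j))) * norm (x - y) \<partial>cond G i t)"
  proof (rule integral_mono)
    show "integrable (cond G i t) (\<lambda>s. (\<Sum>j\<in>- {i}. \<tau> i j * norm (f j (s j) - g j (s j))) * norm (x - y))"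
      using int by (intro integrable_mult_left Bochner_Integration.integrable_sum integrable_mult_right) auto
  qed (use f g t x y in \<open>auto simp: space_cond intro!: integrable_payoff payoff_difference_lipschitz\<close>)
  also have "\<dots> = (\<Sum>j\<in>- {i}. \<tau> i j * (\<integral>u. norm (f j u - g j u) \<partial>coord_cond i j t)) * norm (x - y)"
    using int by (simp add: eq)
  finally have le: "\<sigma> i * (norm (x - y))\<^sup>2
      \<le> (\<Sum>j\<in>- {i}. \<tau> i j * (\<integral>u. norm (f j u - g j u) \<partial>coord_cond i j t)) * norm (x - y)" .
  have "\<sigma> i * norm (x - y) \<le> (\<Sum>j\<in>- {i}. \<tau> i j * (\<integral>u. norm (f j u - g j u) \<partial>coord_cond i j t))"
  proof (cases "x = y")
    case True
    have "0 \<le> \<tau> i j * (\<integral>u. norm (f j u - g j u) \<partial>coord_cond i j t)" if "j \<in> - {i}" for j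
      using that \<tau>_nonneg[of j i] by (intro mult_nonneg_nonneg Bochner_Integration.integral_nonneg) auto
    then have "0 \<le> (\<Sum>j\<in>- {i}. \<tau> i j * (\<integral>u. norm (f j u - g j u) \<partial>coord_cond i j t))"
      by (rule sum_nonneg)
    then show ?thesis using True by simp
  next
    case False
    have "(\<sigma> i * norm (x - y)) * norm (x - y)
        \<le> (\<Sum>j\<in>- {i}. \<tau> i j * (\<integral>u. norm (f j u - g j u) \<partial>coord_cond i j t)) * norm (x - y)"
      using le by (simp only: power2_eq_square mult.assoc)
    then show ?thesis by (rule mult_right_le_imp_le) (use False in simp)
  qed
  then have "norm (x - y) \<le> (\<Sum>j\<in>- {i}. \<tau> i j * (\<integral>u. norm (f j u - g j u) \<partial>coord_cond i j t)) / \<sigma> i"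
    using \<sigma>_pos[of i] by (simp add: pos_le_divide_eq mult.commute)
  then show ?thesis by (simp add: x_def y_def sum_divide_distrib)
qed

text \<open>
  A change of \<open>(x, t)\<close> acts on the integrand, uniformly in the opponents' types, and on the
  conditional law, where the integrand at the base point is a fixed bounded function and setwise
  convergence suffices.
\<close>

lemma continuous_on_expected_util_type:
  assumes cont: "setwise_continuous G" and f: "f \<in> strategies_on G (- {i})"
  shows "continuous_on (actions G i \<times> types G i) (\<lambda>(x, t). expected_util G i x f t)"
  unfolding continuous_on_iff
proof (intro ballI allI impI)
  fix p and e :: real assume p: "p \<in> actions G i \<times> types G i" and "e > 0"
  obtain x t where p_eq: "p = (x, t)" and x: "x \<in> actions G i" and t: "t \<in> types G i" using p by auto
  define I where "I t' = (\<integral>s. payoff i f x t s \<partial>cond G i t')" for t'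
  have "e / 2 > 0" using \<open>e > 0\<close> by simp
  from payoff_uniformly_continuous[OF this, of i] f x t obtain \<delta> where "\<delta> > 0"
    and \<delta>: "\<And>x' t' s. x' \<in> actions G i \<Longrightarrow> t' \<in> types G i \<Longrightarrow> s \<in> PiE (- {i}) (types G) \<Longrightarrow>
      dist (x', t') (x, t) < \<delta> \<Longrightarrow> \<bar>payoff i f x' t' s - payoff i f x t s\<bar> < e / 2"
    by blast
  obtain K where K: "\<forall>f\<in>strategies_on G (- {i}). \<forall>x\<in>actions G i. \<forall>t\<in>types G i. \<forall>s\<in>PiE (- {i}) (types G).
      \<bar>payoff i f x t s\<bar> \<le> K"
    using payoff_bounded by blast
  have "(I \<longlongrightarrow> I t) (at t within types G i)"
    unfolding I_def
  proof (rule tendsto_integral_setwise[OF payoff_measurable_cond[OF f x t], where K = K])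
    show "\<forall>\<^sub>F t' in at t within types G i. prob_space (cond G i t') \<and>
        sets (cond G i t') = sets (profile_algebra (types G) (- {i}))"
      by (auto simp: eventually_at_filter prob_space_cond sets_cond)
    show "((\<lambda>t'. measure (cond G i t') S) \<longlongrightarrow> measure (cond G i t) S) (at t within types G i)"
      if "S \<in> sets (profile_algebra (types G) (- {i}))" for S
      using cont that t by (auto simp: setwise_continuous_def continuous_on_def)
  qed (use K f x t in \<open>auto simp: space_profile_algebra prob_space_cond sets_cond\<close>)
  from tendstoD[OF this \<open>e / 2 > 0\<close>] obtain \<delta>' where "\<delta>' > 0"
    and \<delta>': "\<And>t'. t' \<in> types G i \<Longrightarrow> t' \<noteq> t \<Longrightarrow> dist t' t < \<delta>' \<Longrightarrow> dist (I t') (I t) < e / 2"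
    unfolding eventually_at by auto
  have "dist (expected_util G i x' f t') (expected_util G i x f t) < e"
    if x': "x' \<in> actions G i" and t': "t' \<in> types G i" and d: "dist (x', t') (x, t) < min \<delta> \<delta>'" for x' t'
  proof -
    have "\<bar>expected_util G i x' f t' - I t'\<bar> \<le> e / 2"
      unfolding I_def using expected_util_close[OF f x x' t t' \<delta>[OF x' t']] d by simp
    moreover have "dist t' t \<le> dist (x', t') (x, t)" by (simp add: dist_Pair_Pair)
    then have "dist (I t') (I t) < e / 2"
      using \<delta>'[OF t'] d \<open>e / 2 > 0\<close> by (cases "t' = t") auto
    ultimately show ?thesis unfolding I_def expected_util_eq dist_real_def by linarith
  qed
  then show "\<exists>\<delta>>0. \<forall>q\<in>actions G i \<times> types G i. dist q p < \<delta> \<longrightarrow>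
      dist (case q of (x, t) \<Rightarrow> expected_util G i x f t) (case p of (x, t) \<Rightarrow> expected_util G i x f t) < e"
    using \<open>\<delta> > 0\<close> \<open>\<delta>' > 0\<close> by (intro exI[of _ "min \<delta> \<delta>'"]) (auto simp: p_eq)
qed

lemma response_continuous:
  assumes "setwise_continuous G" "f \<in> strategies_on G (- {i})"
  shows "continuous_on (types G i) (response G f i)"
  by (rule continuous_on_growth_maximizer[OF \<sigma>_pos actions(2) types(2)
        continuous_on_expected_util_type[OF assms]])
    (rule response_growth[OF assms(2)])

end


section \<open>The response operator is a contraction\<close>

text \<open>
  The matrix condition, with row \<open>i\<close> of the conjugated matrix multiplied by \<open>w i\<close> to avoid divisions;
  the matrix norm is a possible value of \<open>c\<close>.
\<close>

locale contractive_game = lipschitz_concave_game G grad \<sigma> \<tau>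
  for G :: "('i::finite, 'a::euclidean_space, 't::euclidean_space) game" and grad \<sigma> \<tau> +
  fixes w :: "'i \<Rightarrow> real" and c :: real
  assumes w_pos: "w i > 0"
    and row_sum_le: "(\<Sum>j\<in>- {i}. \<tau> i j / \<sigma> i * w j) \<le> c * w i"
    and c_less_1: "c < 1"
begin

lemma coeff_nonneg: "j \<in> - {i} \<Longrightarrow> \<tau> i j / \<sigma> i \<ge> 0"
  using \<tau>_nonneg[of j i] \<sigma>_pos[of i] by simp

lemma c_nonneg: "c \<ge> 0"
proof -
  fix i
  have "0 \<le> (\<Sum>j\<in>- {i}. \<tau> i j / \<sigma> i * w j)"
    using coeff_nonneg w_pos by (intro sum_nonneg mult_nonneg_nonneg) (auto simp: less_imp_le)
  then have "0 \<le> c * w i" using row_sum_le[of i] by linarith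
  then show ?thesis using w_pos[of i] by (simp add: zero_le_mult_iff)
qed

lemma strategies_others:
  assumes "f \<in> strategies G"
  shows "f \<in> strategies_on G (- {i})" and "f \<in> strategies_on G {i}"
  using assms strategies_on_mono[OF subset_UNIV] by auto

text \<open>
  If each component of \<open>f - g\<close> is at most \<open>w j * N\<close> almost surely under the law that player \<open>i\<close>
  assigns to it, the Lipschitz estimate and the row sum bound give a factor \<open>c\<close>. Serves both the
  supremum norm and \<open>p = \<infinity>\<close>.
\<close>

lemma response_le_AE:
  assumes f: "f \<in> strategies G" and g: "g \<in> strategies G" and t: "t \<in> types G i" and N: "N \<ge> 0"
    and le: "\<And>j. j \<noteq> i \<Longrightarrow> AE u in coord_cond i j t. norm (f j u - g j u) \<le> w j * N"
  shows "norm (response G f i t - response G g i t) \<le> c * (w i * N)"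
proof -
  have "norm (response G f i t - response G g i t)
      \<le> (\<Sum>j\<in>- {i}. \<tau> i j / \<sigma> i * (\<integral>u. norm (f j u - g j u) \<partial>coord_cond i j t))"
    using f g t by (intro response_lipschitz strategies_others)
  also have "\<dots> \<le> (\<Sum>j\<in>- {i}. \<tau> i j / \<sigma> i * (w j * N))"
  proof (intro sum_mono mult_left_mono coeff_nonneg)
    fix j assume j: "j \<in> - {i}"
    then interpret prob_space "coord_cond i j t" using t by (intro prob_space_coord_cond) auto
    have "(\<integral>u. norm (f j u - g j u) \<partial>coord_cond i j t) \<le> (\<integral>u. w j * N \<partial>coord_cond i j t)"
      using le[of j] j w_pos[of j] N by (intro integral_mono_AE') auto
    then show "(\<integral>u. norm (f j u - g j u) \<partial>coord_cond i j t) \<le> w j * N" by (simp add: prob_space)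
  qed
  also have "\<dots> = (\<Sum>j\<in>- {i}. \<tau> i j / \<sigma> i * w j) * N"
    by (simp add: sum_distrib_right mult.assoc)
  also have "\<dots> \<le> c * w i * N"
    using row_sum_le N by (rule mult_right_mono)
  finally show ?thesis by (simp add: mult.assoc)
qed

lemma response_le_pointwise:
  assumes f: "f \<in> strategies G" and g: "g \<in> strategies G" and t: "t \<in> types G i"
    and le: "\<And>j u. u \<in> types G j \<Longrightarrow> norm (f j u - g j u) \<le> w j * N"
  shows "norm (response G f i t - response G g i t) \<le> c * (w i * N)"
proof (rule response_le_AE[OF f g t])
  have "0 \<le> w i * N" using le[OF t] norm_ge_zero order_trans by blast
  then show "N \<ge> 0" using w_pos[of i] by (simp add: zero_le_mult_iff)
  show "AE u in coord_cond i j t. norm (f j u - g j u) \<le> w j * N" if "j \<noteq> i" for j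
    using le space_coord_cond[OF that t] by (intro AE_I2) auto
qed

text \<open>
  Scale the differences to \<open>e j = |f j - g j| / w j\<close>, so that the Lipschitz estimate has coefficients
  \<open>a j\<close> with sum \<open>W \<le> c * w i\<close>. Jensen's inequality for the sum and for each conditional law moves
  the power inside, and integrating over the own type replaces conditional laws by marginals, where
  the integral of \<open>e j powr r\<close> is at most \<open>N powr r\<close>. The power means thereby also do the work of
  Minkowski's inequality.
\<close>

lemma response_le_Lp:
  assumes f: "f \<in> strategies G" and g: "g \<in> strategies G" and r: "r \<ge> 1" and N: "N \<ge> 0"
    and le: "\<And>j. (\<integral>u. norm (f j u - g j u) powr r \<partial>marginal G j) \<le> (w j * N) powr r"
  shows "(\<integral>t. norm (response G f i t - response G g i t) powr r \<partial>marginal G i) \<le> (c * (w i * N)) powr r"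
proof -
  define a where "a j = \<tau> i j / \<sigma> i * w j" for j
  define W where "W = (\<Sum>j\<in>- {i}. a j)"
  define e where "e j u = norm (f j u - g j u) / w j" for j u
  obtain K where K: "\<And>j f g u. f \<in> strategies_on G {j} \<Longrightarrow> g \<in> strategies_on G {j} \<Longrightarrow> u \<in> types G j \<Longrightarrow>
      norm (f j u - g j u) \<le> K"
    using strategy_diff_bounded by blast
  have a: "a j \<ge> 0" if "j \<in> - {i}" for j
    unfolding a_def using coeff_nonneg[OF that] w_pos[of j] by (intro mult_nonneg_nonneg) auto
  then have W: "W \<ge> 0" unfolding W_def by (rule sum_nonneg)
  have e: "0 \<le> e j u \<and> e j u \<le> K / w j" if "u \<in> types G j" for j u
    unfolding e_def using K[of f j g u] f g that w_pos[of j]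
    by (auto intro!: divide_right_mono strategies_others)
  have e_meas: "e j \<in> borel_measurable (borel_on (types G j))" for j
    unfolding e_def using strategy_diff_measurable[OF f g, of j] by measurable
  have er: "0 \<le> e j u powr r \<and> e j u powr r \<le> (K / w j) powr r" if "u \<in> types G j" for j u
    using e[OF that] r by (auto intro!: powr_mono2)
  have er_meas: "(\<lambda>u. e j u powr r) \<in> borel_measurable (borel_on (types G j))" for j
    using e_meas[of j] by measurable
  have e_le: "(\<integral>u. e j u powr r \<partial>marginal G j) \<le> N powr r" for j
  proof -
    have "(\<integral>u. e j u powr r \<partial>marginal G j) = (\<integral>u. norm (f j u - g j u) powr r \<partial>marginal G j) / w j powr r"
      unfolding e_def using w_pos[of j] by (simp add: powr_divide)
    also have "\<dots> \<le> (w j * N) powr r / w j powr r" by (intro divide_right_mono le) auto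
    also have "\<dots> = N powr r" using w_pos[of j] N by (simp add: powr_mult)
    finally show ?thesis .
  qed
  have pointwise: "norm (response G f i t - response G g i t) powr r
      \<le> W powr (r - 1) * (\<Sum>j\<in>- {i}. a j * (\<integral>u. e j u powr r \<partial>coord_cond i j t))"
    if t: "t \<in> types G i" for t
  proof -
    have coord: "(\<integral>u. e j u \<partial>coord_cond i j t) \<ge> 0"
      "(\<integral>u. e j u \<partial>coord_cond i j t) powr r \<le> (\<integral>u. e j u powr r \<partial>coord_cond i j t)"
      if j: "j \<in> - {i}" for j
    proof -
      have ij: "j \<noteq> i" using j by simp
      interpret prob_space "coord_cond i j t" using ij t by (rule prob_space_coord_cond)
      show "(\<integral>u. e j u \<partial>coord_cond i j t) \<ge> 0"
        using e space_coord_cond[OF ij t] by (intro Bochner_Integration.integral_nonneg) auto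
      have "e j \<in> borel_measurable (coord_cond i j t)"
        using e_meas[of j] sets_coord_cond[OF ij t] by (simp cong: measurable_cong_sets)
      then show "(\<integral>u. e j u \<partial>coord_cond i j t) powr r \<le> (\<integral>u. e j u powr r \<partial>coord_cond i j t)"
        using e space_coord_cond[OF ij t] by (intro integral_powr_le[OF r, of _ "K / w j"]) auto
    qed
    have "norm (response G f i t - response G g i t)
        \<le> (\<Sum>j\<in>- {i}. \<tau> i j / \<sigma> i * (\<integral>u. norm (f j u - g j u) \<partial>coord_cond i j t))"
      using f g t by (intro response_lipschitz strategies_others)
    also have "\<dots> = (\<Sum>j\<in>- {i}. a j * (\<integral>u. e j u \<partial>coord_cond i j t))"
      unfolding a_def e_def using w_pos[THEN less_imp_neq, THEN not_sym] by (intro sum.cong) auto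
    finally have "norm (response G f i t - response G g i t) powr r
        \<le> (\<Sum>j\<in>- {i}. a j * (\<integral>u. e j u \<partial>coord_cond i j t)) powr r"
      using r by (intro powr_mono2) auto
    also have "\<dots> \<le> W powr (r - 1) * (\<Sum>j\<in>- {i}. a j * (\<integral>u. e j u \<partial>coord_cond i j t) powr r)"
      unfolding W_def using a coord(1) by (intro powr_weighted_sum_le r) auto
    also have "\<dots> \<le> W powr (r - 1) * (\<Sum>j\<in>- {i}. a j * (\<integral>u. e j u powr r \<partial>coord_cond i j t))"
      using a coord(2) by (intro mult_left_mono sum_mono) auto
    finally show ?thesis .
  qed
  have disint: "integrable (marginal G i) (\<lambda>t. \<integral>u. e j u powr r \<partial>coord_cond i j t)"
    "(\<integral>t. \<integral>u. e j u powr r \<partial>coord_cond i j t \<partial>marginal G i) = (\<integral>u. e j u powr r \<partial>marginal G j)"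
    if "j \<in> - {i}" for j
    using integral_marginal[of j i, OF _ er_meas er] that by auto
  have "integrable (marginal G i) (\<lambda>t. W powr (r - 1) * (\<Sum>j\<in>- {i}. a j * (\<integral>u. e j u powr r \<partial>coord_cond i j t)))"
    using disint(1) by (intro integrable_mult_right Bochner_Integration.integrable_sum) auto
  then have "(\<integral>t. norm (response G f i t - response G g i t) powr r \<partial>marginal G i)
      \<le> (\<integral>t. W powr (r - 1) * (\<Sum>j\<in>- {i}. a j * (\<integral>u. e j u powr r \<partial>coord_cond i j t)) \<partial>marginal G i)"
    using pointwise order_trans[OF powr_ge_zero pointwise]
    by (intro integral_mono') (auto simp: space_marginal)
  also have "\<dots> = W powr (r - 1) * (\<Sum>j\<in>- {i}. a j * (\<integral>u. e j u powr r \<partial>marginal G j))"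
    using disint by simp
  also have "\<dots> \<le> W powr (r - 1) * (\<Sum>j\<in>- {i}. a j * N powr r)"
    using a e_le by (intro mult_left_mono sum_mono) auto
  also have "\<dots> = W powr (r - 1) * W * N powr r"
    by (simp add: W_def sum_distrib_right)
  \<comment> \<open>If \<open>W = 0\<close>, both sides vanish because \<open>0 powr r = 0\<close>.\<close>
  also have "\<dots> = (W * N) powr r"
    using W N by (cases "W = 0") (auto simp: powr_mult powr_diff)
  also have "\<dots> \<le> (c * (w i * N)) powr r"
  proof (rule powr_mono2)
    have "W \<le> c * w i" unfolding W_def a_def by (rule row_sum_le)
    from mult_right_mono[OF this N] show "W * N \<le> c * (w i * N)" by (simp only: mult.assoc)
  qed (use r W N in auto)
  finally show ?thesis .
qed

lemma weighted_max_le_iff: "(MAX i. 1 / w i * x i) \<le> b \<longleftrightarrow> (\<forall>i. x i \<le> w i * b)"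
  using w_pos by (subst Max_le_iff) (auto simp: field_simps)

lemma diff_measurable_marginal:
  assumes "f \<in> strategies G" "g \<in> strategies G"
  shows "(\<lambda>u. norm (f j u - g j u)) \<in> borel_measurable (marginal G j)"
  using strategy_diff_measurable[OF assms, of j] sets_marginal[of j] by (simp cong: measurable_cong_sets)

text \<open>
  For \<open>p = \<infinity>\<close>, the bound \<open>w j * N\<close> on \<open>f j - g j\<close> holds almost everywhere for the marginal of
  \<open>\<theta>\<^sub>j\<close>, hence almost surely under the conditional law for almost every own type; the finitely many
  exceptional sets, one for each opponent, are null together.
\<close>

lemma response_contraction_Lp:
  assumes p: "p \<ge> 1"
  shows "contraction_wrt (weighted_Lp_norm G w p) (strategies G) (response G)"
  unfolding contraction_wrt_def
proof (intro conjI ballI exI[of _ c] response_in_strategies c_less_1)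
  fix f g assume f: "f \<in> strategies G" and g: "g \<in> strategies G"
  define N where "N = weighted_Lp_norm G w p (\<lambda>i t. f i t - g i t)"
  have norm_le: "Lp_norm p (marginal G j) (\<lambda>t. f j t - g j t) \<le> w j * N" for j
    unfolding N_def weighted_Lp_norm_def
    by (rule weighted_max_le_iff[THEN iffD1, rule_format, OF order_refl])
  note Psi = response_in_strategies[OF f] response_in_strategies[OF g]
  have "Lp_norm p (marginal G i) (\<lambda>t. response G f i t - response G g i t) \<le> w i * (c * N)" for i
  proof (cases "p = \<infinity>")
    case True
    obtain K where K: "\<And>j f g u. f \<in> strategies_on G {j} \<Longrightarrow> g \<in> strategies_on G {j} \<Longrightarrow> u \<in> types G j \<Longrightarrow>
        norm (f j u - g j u) \<le> K"
      using strategy_diff_bounded by blast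
    have AE: "AE u in marginal G j. norm (f j u - g j u) \<le> w j * N" for j
    proof -
      have "AE u in marginal G j. norm (f j u - g j u) \<le> Lp_norm \<infinity> (marginal G j) (\<lambda>t. f j t - g j t)"
        using K[of f j g] f g
        by (intro AE_le_Lp_norm_top[of _ _ K] diff_measurable_marginal) (auto simp: space_marginal strategies_others)
      then show ?thesis using norm_le[of j] True by (auto elim!: eventually_mono)
    qed
    interpret prob_space "marginal G i" by (rule prob_space_marginal)
    have "AE u in marginal G i. 0 \<le> w i * N"
      using AE[of i] by eventually_elim (use norm_ge_zero order_trans in blast)
    then have N: "N \<ge> 0" using w_pos[of i] by (simp add: zero_le_mult_iff)
    have "AE t in marginal G i. \<forall>j\<in>- {i}. AE u in coord_cond i j t. norm (f j u - g j u) \<le> w j * N"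
    proof (subst AE_finite_all, simp, intro ballI)
      fix j assume j: "j \<in> - {i}"
      have "Measurable.pred (borel_on (types G j)) (\<lambda>u. norm (f j u - g j u) \<le> w j * N)"
        using strategy_diff_measurable[OF f g, of j] by measurable
      then show "AE t in marginal G i. AE u in coord_cond i j t. norm (f j u - g j u) \<le> w j * N"
        using AE_marginal_iff[of j i] AE[of j] j by auto
    qed
    then have "AE t in marginal G i. norm (response G f i t - response G g i t) \<le> w i * (c * N)"
      using AE_space
    proof eventually_elim
      case (elim t)
      then have "norm (response G f i t - response G g i t) \<le> c * (w i * N)"
        by (intro response_le_AE[OF f g _ N]) (auto simp: space_marginal)
      then show ?case by (simp add: mult_ac)
    qed
    then show ?thesis
      unfolding True using N c_nonneg w_pos[of i] diff_measurable_marginal[OF Psi]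
      by (intro Lp_norm_top_le) auto
  next
    case False
    then obtain r where p_eq: "p = ennreal r" and "r \<ge> 0" by (cases p) auto
    then have r: "r \<ge> 1" using p by (simp add: ennreal_1[symmetric] del: ennreal_1)
    have "Lp_norm p (marginal G i) (\<lambda>t. f i t - g i t) \<ge> 0"
      unfolding Lp_norm_def if_not_P[OF False] by (rule powr_ge_zero)
    then have "0 \<le> w i * N" using norm_le[of i] by linarith
    then have N: "N \<ge> 0" using w_pos[of i] by (simp add: zero_le_mult_iff)
    have "(\<integral>u. norm (f j u - g j u) powr r \<partial>marginal G j) \<le> (w j * N) powr r" for j
      using norm_le[of j] w_pos[of j] N unfolding p_eq by (subst (asm) Lp_norm_le_iff[OF r]) auto
    from response_le_Lp[OF f g r N this, of i] show ?thesis
      unfolding p_eq using w_pos[of i] N c_nonneg by (subst Lp_norm_le_iff[OF r]) (auto simp: mult_ac)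
  qed
  then show "weighted_Lp_norm G w p (\<lambda>i t. response G f i t - response G g i t)
      \<le> c * weighted_Lp_norm G w p (\<lambda>i t. f i t - g i t)"
    unfolding N_def[symmetric] weighted_Lp_norm_def[of G w p "\<lambda>i t. response G f i t - response G g i t"]
    by (subst weighted_max_le_iff) auto
qed

lemma norm_diff_le_weighted_sup_norm:
  assumes f: "f \<in> strategies G" and g: "g \<in> strategies G" and t: "t \<in> types G i"
  shows "norm (f i t - g i t) \<le> w i * weighted_sup_norm G w (\<lambda>i t. f i t - g i t)"
proof -
  obtain K where K: "\<And>j f g u. f \<in> strategies_on G {j} \<Longrightarrow> g \<in> strategies_on G {j} \<Longrightarrow> u \<in> types G j \<Longrightarrow>
      norm (f j u - g j u) \<le> K"
    using strategy_diff_bounded by blast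
  have "norm (f i t - g i t) \<le> (SUP t \<in> types G i. norm (f i t - g i t))"
    using K[of f i g] f g t by (intro cSUP_upper bdd_aboveI2[of _ _ K]) (auto simp: strategies_others)
  also have "\<dots> \<le> w i * weighted_sup_norm G w (\<lambda>i t. f i t - g i t)"
    unfolding weighted_sup_norm_def by (rule weighted_max_le_iff[THEN iffD1, rule_format, OF order_refl])
  finally show ?thesis .
qed

lemma response_contraction_sup:
  "contraction_wrt (weighted_sup_norm G w) (strategies G) (response G)"
  unfolding contraction_wrt_def
proof (intro conjI ballI exI[of _ c] response_in_strategies c_less_1)
  fix f g assume f: "f \<in> strategies G" and g: "g \<in> strategies G"
  define N where "N = weighted_sup_norm G w (\<lambda>i t. f i t - g i t)"
  have "(SUP t \<in> types G i. norm (response G f i t - response G g i t)) \<le> w i * (c * N)" for i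
  proof (rule cSUP_least)
    show "types G i \<noteq> {}" by (rule types)
    show "norm (response G f i t - response G g i t) \<le> w i * (c * N)" if "t \<in> types G i" for t
      using response_le_pointwise[OF f g that, of N] norm_diff_le_weighted_sup_norm[OF f g]
      by (simp add: N_def mult_ac)
  qed
  then show "weighted_sup_norm G w (\<lambda>i t. response G f i t - response G g i t)
      \<le> c * weighted_sup_norm G w (\<lambda>i t. f i t - g i t)"
    unfolding N_def[symmetric] weighted_sup_norm_def[of G w "\<lambda>i t. response G f i t - response G g i t"]
    by (subst weighted_max_le_iff) auto
qed


section \<open>Equilibria\<close>

lemma BNE_iff:
  "BNE G f \<longleftrightarrow> f \<in> strategies G \<and> (\<forall>i. \<forall>t\<in>types G i. f i t = response G f i t)"
  using best_response_iff[OF strategies_others(1)] by (auto simp: BNE_def)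

lemma BNE_unique:
  assumes f: "BNE G f" and g: "BNE G g" and t: "t \<in> types G i"
  shows "f i t = g i t"
proof -
  have fg: "f \<in> strategies G" "g \<in> strategies G" using f g by (auto simp: BNE_iff)
  define N where "N = weighted_sup_norm G w (\<lambda>i t. f i t - g i t)"
  have le: "norm (f j u - g j u) \<le> w j * N" if "u \<in> types G j" for j u
    unfolding N_def using fg that by (rule norm_diff_le_weighted_sup_norm)
  have "norm (f j u - g j u) \<le> w j * (c * N)" if u: "u \<in> types G j" for j u
    using response_le_pointwise[OF fg u le] f g u by (simp add: BNE_iff mult_ac)
  then have "(SUP t \<in> types G j. norm (f j t - g j t)) \<le> w j * (c * N)" for j
    by (intro cSUP_least types)
  then have "N \<le> c * N"
    unfolding N_def[unfolded weighted_sup_norm_def] weighted_max_le_iff by blast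
  then have "(1 - c) * N \<le> 0" by (simp add: algebra_simps)
  then have "N \<le> 0" using c_less_1 by (simp add: mult_le_0_iff)
  then have "w i * N \<le> 0" using w_pos[of i] by (simp add: mult_le_0_iff)
  with le[OF t] have "norm (f i t - g i t) \<le> 0" by (rule order_trans)
  then show ?thesis by simp
qed

text \<open>
  Banach's iteration in the supremum norm. The increments decay geometrically, so the iterates
  converge uniformly; the limit is measurable and takes values in the closed action sets, hence is a
  strategy, and it is a fixed point because the operator is nonexpansive.
\<close>

lemma BNE_exists: "\<exists>f. BNE G f"
proof -
  define f0 where "f0 i t = (SOME x. x \<in> actions G i)" for i and t :: 't
  define F where "F n = (response G ^^ n) f0" for n
  have "(SOME x. x \<in> actions G i) \<in> actions G i" for i using actions(1)[of i] by (simp add: some_in_eq)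
  then have f0: "f0 \<in> strategies G"
    unfolding strategies_on_def f0_def by (auto simp: space_restrict_space)
  have F: "F n \<in> strategies G" for n
    by (induction n) (auto simp: F_def f0 response_in_strategies)
  define C where "C = weighted_sup_norm G w (\<lambda>i t. F 1 i t - F 0 i t)"
  have step: "norm (F (Suc n) i t - F n i t) \<le> w i * (c ^ n * C)" if "t \<in> types G i" for n i t
    using that
  proof (induction n arbitrary: i t)
    case 0
    then show ?case using norm_diff_le_weighted_sup_norm[OF F F 0] by (simp add: C_def)
  next
    case (Suc n)
    have "norm (response G (F (Suc n)) i t - response G (F n) i t) \<le> c * (w i * (c ^ n * C))"
      by (rule response_le_pointwise[OF F F Suc.prems Suc.IH])
    then show ?case by (simp add: F_def mult_ac)
  qed
  define L where "L i t = F 0 i t + (\<Sum>n. F (Suc n) i t - F n i t)" for i t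
  have lim: "uniform_limit (types G i) (\<lambda>n. F n i) (L i) sequentially" for i
  proof -
    have "summable (\<lambda>n. w i * (c ^ n * C))"
      using c_nonneg c_less_1 by (intro summable_mult summable_mult2 summable_geometric) auto
    with step have "uniform_limit (types G i) (\<lambda>n t. \<Sum>k<n. F (Suc k) i t - F k i t)
        (\<lambda>t. \<Sum>k. F (Suc k) i t - F k i t) sequentially"
      by (rule Weierstrass_m_test)
    then have "uniform_limit (types G i) (\<lambda>n t. F 0 i t + (\<Sum>k<n. F (Suc k) i t - F k i t)) (L i) sequentially"
      unfolding L_def by (intro uniform_limit_add uniform_limit_const)
    moreover have "F 0 i t + (\<Sum>k<n. F (Suc k) i t - F k i t) = F n i t" for n t
      using sum_lessThan_telescope[of "\<lambda>k. F k i t" n] by simp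
    ultimately show ?thesis by simp
  qed
  have pointwise: "(\<lambda>n. F n i t) \<longlonglongrightarrow> L i t" if "t \<in> types G i" for i t
    using tendsto_uniform_limitI[OF lim that] .
  have L: "L \<in> strategies G"
    unfolding strategies_on_def mem_Collect_eq measurable_restrict_space2_iff
  proof (intro ballI conjI)
    fix i
    show "L i \<in> borel_measurable (borel_on (types G i))"
    proof (rule borel_measurable_LIMSEQ_metric)
      show "F n i \<in> borel_measurable (borel_on (types G i))" for n
        by (rule strategyD(1)[OF F]) simp
      show "(\<lambda>n. F n i t) \<longlonglongrightarrow> L i t" if "t \<in> space (borel_on (types G i))" for t
        using that by (intro pointwise) (simp add: space_restrict_space)
    qed
    have "L i t \<in> actions G i" if t: "t \<in> types G i" for t
    proof (rule closed_sequentially[OF compact_imp_closed[OF actions(2)] _ pointwise[OF t]])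
      show "F n i t \<in> actions G i" for n by (rule strategyD(2)[OF F _ t]) simp
    qed
    then show "L i \<in> space (borel_on (types G i)) \<rightarrow> actions G i" by (auto simp: space_restrict_space)
  qed
  have "L i t = response G L i t" if t: "t \<in> types G i" for i t
  proof -
    have "norm (L i t - response G L i t) \<le> 0 + e" if "e > 0" for e
    proof -
      \<comment> \<open>Two errors of at most \<open>w i * d\<close> each: from the iterate to the limit, and after one application of the operator.\<close>
      define d where "d = e / (2 * w i)"
      have d: "d > 0" using that w_pos[of i] by (simp add: d_def)
      have "\<forall>\<^sub>F n in sequentially. \<forall>j. \<forall>u\<in>types G j. dist (F n j u) (L j u) < w j * d"
        using lim d w_pos by (intro eventually_all_finite) (auto intro!: uniform_limitD)
      then obtain n where n: "\<And>m j u. m \<ge> n \<Longrightarrow> u \<in> types G j \<Longrightarrow> dist (F m j u) (L j u) < w j * d"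
        unfolding eventually_sequentially by blast
      have "norm (F (Suc n) i t - response G L i t) = norm (response G (F n) i t - response G L i t)"
        by (simp add: F_def)
      also have "\<dots> \<le> c * (w i * d)"
        using n[of n] by (intro response_le_pointwise[OF F L t]) (auto simp: dist_norm less_imp_le)
      also have "\<dots> \<le> 1 * (w i * d)"
        using c_less_1 w_pos[of i] d by (intro mult_right_mono) auto
      finally have "norm (F (Suc n) i t - response G L i t) \<le> w i * d" by simp
      moreover have "norm (F (Suc n) i t - L i t) < w i * d"
        using n[of "Suc n", OF _ t] by (simp add: dist_norm)
      ultimately have "norm (L i t - response G L i t) \<le> w i * d + w i * d"
        by (smt (verit) norm_minus_commute norm_triangle_le_diff norm_diff_triangle_le)
      also have "\<dots> = e" using w_pos[of i] by (simp add: d_def field_simps)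
      finally show ?thesis by simp
    qed
    then have "norm (L i t - response G L i t) \<le> 0" by (rule field_le_epsilon)
    then show ?thesis by simp
  qed
  with L show ?thesis by (auto simp: BNE_iff)
qed

lemma BNE_continuous:
  assumes "setwise_continuous G" and f: "BNE G f"
  shows "continuous_on (types G i) (f i)"
proof -
  have "continuous_on (types G i) (response G f i)"
    using assms by (intro response_continuous strategies_others) (auto simp: BNE_iff)
  then show ?thesis
    using f by (subst continuous_on_cong[where g = "response G f i"]) (auto simp: BNE_iff)
qed

end

theorem theorem4p1:
  fixes G :: "('i::finite, 'a::euclidean_space, 't::euclidean_space) game"
    and grad :: "'i \<Rightarrow> ('i \<Rightarrow> 'a) \<Rightarrow> ('i \<Rightarrow> 't) \<Rightarrow> 'a"
    and \<sigma> :: "'i \<Rightarrow> real" and \<tau> :: "'i \<Rightarrow> 'i \<Rightarrow> real" and w :: "'i \<Rightarrow> real"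
  assumes game: "bayesian_game G"
    and grad: "action_gradient G grad"
    and A: "assumption_A G grad"
    and B: "assumption_B G grad \<sigma> \<tau>"
    and w_pos: "\<forall>i. w i > 0"
    and M: "matrix_inf_norm
              (matrix_inv (diag_matrix w) ** interaction_matrix \<sigma> \<tau> ** diag_matrix w) < 1"
  shows
    "(\<forall>f \<in> strategies G. \<forall>i. \<forall>t \<in> types G i. \<exists>!x. is_best_response G i f t x) \<and>
     ((\<forall>p \<ge> 1. contraction_wrt (weighted_Lp_norm G w p) (strategies G) (response G)) \<and>
      (\<exists>f. BNE G f) \<and>
      (\<forall>f g. BNE G f \<and> BNE G g \<longrightarrow> (\<forall>i. AE t in marginal G i. f i t = g i t))) \<and>
     (contraction_wrt (weighted_sup_norm G w) (strategies G) (response G) \<and>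
      (\<forall>f g. BNE G f \<and> BNE G g \<longrightarrow> (\<forall>i. \<forall>t \<in> types G i. f i t = g i t))) \<and>
     (setwise_continuous G \<longrightarrow>
        (\<forall>f. BNE G f \<longrightarrow> (\<forall>i. continuous_on (types G i) (f i))) \<and>
        (\<exists>f. continuous_BNE G f) \<and>
        (\<forall>f g. continuous_BNE G f \<and> continuous_BNE G g \<longrightarrow>
           (\<forall>i. \<forall>t \<in> types G i. f i t = g i t)))"
proof -
  interpret contractive_game G grad \<sigma> \<tau> w
    "matrix_inf_norm (matrix_inv (diag_matrix w) ** interaction_matrix \<sigma> \<tau> ** diag_matrix w)"
    by unfold_locales
      (rule game grad A B M w_pos[rule_format] weighted_row_sum_le[OF w_pos[rule_format]])+
  show ?thesis
  proof (intro conjI impI allI ballI)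
    show "\<exists>!x. is_best_response G i f t x" if "f \<in> strategies G" "t \<in> types G i" for f i t
      using that by (intro best_response_unique strategies_others)
    show "contraction_wrt (weighted_Lp_norm G w p) (strategies G) (response G)" if "1 \<le> p" for p
      using that by (rule response_contraction_Lp)
    show "contraction_wrt (weighted_sup_norm G w) (strategies G) (response G)"
      by (rule response_contraction_sup)
    show "\<exists>f. BNE G f" by (rule BNE_exists)
    show "f i t = g i t" if "BNE G f \<and> BNE G g" "t \<in> types G i" for f g i t
      using that BNE_unique by blast
    show "AE t in marginal G i. f i t = g i t" if "BNE G f \<and> BNE G g" for f g i
      using that BNE_unique by (intro AE_I2) (auto simp: space_marginal)
    show "continuous_on (types G i) (f i)" if "setwise_continuous G" "BNE G f" for f i
      using that by (rule BNE_continuous)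
    show "\<exists>f. continuous_BNE G f" if "setwise_continuous G"
      using that BNE_exists BNE_continuous by (auto simp: continuous_BNE_def)
    show "f i t = g i t" if "continuous_BNE G f \<and> continuous_BNE G g" "t \<in> types G i" for f g i t
      using that BNE_unique by (auto simp: continuous_BNE_def)
  qed
qed

end
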